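(* Let $l\geq k\geq 2$ and let $\mathcal{F}$ be a family of $k$-graphs such that $(\mathcal{F},K^{k}_{l})$ is a Turán pair and $\mathcal{F}$ is degree-stable with respect to $\mathrm{Col}(K^{k}_{l})$. Then for any $\alpha>1$ there exists $n_{0}$ such that if $G$ is an $\mathcal{F}$-free $k$-graph on $n\geq n_{0}$ vertices, then $\lambda_{\alpha}(G)\leq\lambda_{\alpha}(T^{k}_{l}(n))$, with equality if and only if $G=T^{k}_{l}(n)$.
   Context: A $k$-graph is a hypergraph whose edges all have $k$ vertices; $\mathcal{F}$-free means containing no member of $\mathcal{F}$ as a sub-hypergraph; $\delta(H)$ is the minimum degree (degree = number of edges containing the vertex). $\pi(\mathcal{F})=\lim_{n\to\infty}\mathrm{ex}(n,\mathcal{F})/\binom{n}{k}$, where $\mathrm{ex}(n,\mathcal{F})$ is the max number of edges of an $n$-vertex $\mathcal{F}$-free $k$-graph. A $k$-pattern is a pair $P=([l],E)$ with $E$ a collection of $k$-multisets of elements of $[l]$; a $k$-graph $H$ is $P$-colorable if there is a map $\phi:V(H)\to[l]$ such that for every edge $\{v_1,\dots,v_k\}$ the multiset $\{\phi(v_1),\dots,\phi(v_k)\}$ belongs to $E$. $K^k_l$ is the complete $k$-graph on $[l]$ (viewed as a pattern), so $K^k_l$-colorable means $l$-partite (each edge has at most one vertex in each of $l$ parts). $\mathrm{Col}(P)$ is the set of all $P$-colorable $k$-graphs. $(\mathcal{F},P)$ is a Turán pair if every $P$-colorable $k$-graph is $\mathcal{F}$-free and every $\mathcal{F}$-free $k$-graph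 with the maximum number of edges (for its number of vertices) is $P$-colorable. For a family $\mathcal{F}$ of $k$-graphs with $\pi(\mathcal{F})>0$ and a family $\mathfrak{H}$ of $\mathcal{F}$-free $k$-graphs, $\mathcal{F}$ is degree-stable with respect to $\mathfrak{H}$ if there exist $\varepsilon>0$ and $n_0$ such that every $\mathcal{F}$-free $k$-graph $H$ on $n\geq n_0$ vertices with $\delta(H)\geq(\pi(\mathcal{F})/(k-1)!-\varepsilon)n^{k-1}$ belongs to $\mathfrak{H}$. $T^k_l(n)$ is the complete $l$-partite $k$-graph on $n$ vertices with part sizes differing by at most $1$. For $\alpha>1$, $\lambda_\alpha(G)=\max\{k!\sum_{\{i_1,\dots,i_k\}\in E(G)}x_{i_1}\cdots x_{i_k}:\ \mathbf{x}\in\mathbb{R}^{V(G)},\ \sum_i|x_i|^\alpha=1\}$. *)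

theory Defs
  imports Complex_Main "HOL-Library.Multiset"
begin

text \<open>Finite \<open>k\<close>-graphs are pairs (vertex set, edge set). Families of \<open>k\<close>-graphs are considered
  up to isomorphism, so vertices are drawn from the countable pool \<^typ>\<open>nat\<close>.\<close>

type_synonym hypergraph = "nat set \<times> nat set set"

abbreviation verts :: "hypergraph \<Rightarrow> nat set" where "verts \<equiv> fst"
abbreviation edges :: "hypergraph \<Rightarrow> nat set set" where "edges \<equiv> snd"

definition kgraph :: "nat \<Rightarrow> hypergraph \<Rightarrow> bool" where
  "kgraph k H \<longleftrightarrow> finite (verts H) \<and> (\<forall>e\<in>edges H. e \<subseteq> verts H \<and> card e = k)"

definition contains_copy :: "hypergraph \<Rightarrow> hypergraph \<Rightarrow> bool" where
  "contains_copy H A \<longleftrightarrow>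
     (\<exists>f. inj_on f (verts A) \<and> f ` verts A \<subseteq> verts H \<and> (\<forall>e\<in>edges A. f ` e \<in> edges H))"

definition isomorphic :: "hypergraph \<Rightarrow> hypergraph \<Rightarrow> bool" where
  "isomorphic G H \<longleftrightarrow>
     (\<exists>f. bij_betw f (verts G) (verts H) \<and> (\<lambda>e. f ` e) ` edges G = edges H)"

definition free_of :: "hypergraph set \<Rightarrow> hypergraph \<Rightarrow> bool" where
  "free_of \<F> H \<longleftrightarrow> (\<forall>A\<in>\<F>. \<not> contains_copy H A)"

definition vertex_degree :: "hypergraph \<Rightarrow> nat \<Rightarrow> nat" where
  "vertex_degree H v = card {e \<in> edges H. v \<in> e}"

definition min_degree :: "hypergraph \<Rightarrow> nat" where
  "min_degree H = Min (vertex_degree H ` verts H)"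

definition ex_number :: "nat \<Rightarrow> nat \<Rightarrow> hypergraph set \<Rightarrow> nat" where
  "ex_number k n \<F> = Max {card (edges H) | H. kgraph k H \<and> card (verts H) = n \<and> free_of \<F> H}"

definition turan_density :: "nat \<Rightarrow> hypergraph set \<Rightarrow> real" where
  "turan_density k \<F> = lim (\<lambda>n. real (ex_number k n \<F>) / real (n choose k))"

text \<open>A pattern \<open>([l], E)\<close> is represented by the pair \<open>(l, E)\<close>.\<close>

type_synonym pattern = "nat \<times> nat multiset set"

definition kpattern :: "nat \<Rightarrow> pattern \<Rightarrow> bool" where
  "kpattern k P \<longleftrightarrow> (\<forall>M\<in>snd P. set_mset M \<subseteq> {1..fst P} \<and> size M = k)"

definition colorable :: "pattern \<Rightarrow> hypergraph \<Rightarrow> bool" where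
  "colorable P H \<longleftrightarrow>
     (\<exists>\<phi>. \<phi> ` verts H \<subseteq> {1..fst P} \<and> (\<forall>e\<in>edges H. image_mset \<phi> (mset_set e) \<in> snd P))"

definition Col :: "nat \<Rightarrow> pattern \<Rightarrow> hypergraph set" where
  "Col k P = {H. kgraph k H \<and> colorable P H}"

definition complete_pattern :: "nat \<Rightarrow> nat \<Rightarrow> pattern" where
  "complete_pattern k l = (l, mset_set ` {e. e \<subseteq> {1..l} \<and> card e = k})"

lemma kpattern_complete_pattern: "kpattern k (complete_pattern k l)"
proof -
  have "set_mset (mset_set e) \<subseteq> {1..l}" if "e \<subseteq> {1..l}" for e
    using that finite_subset[OF that] by simp
  then show ?thesis
    by (simp add: kpattern_def complete_pattern_def)
qed

definition turan_pair :: "nat \<Rightarrow> hypergraph set \<Rightarrow> pattern \<Rightarrow> bool" where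
  "turan_pair k \<F> P \<longleftrightarrow>
     (\<forall>H. kgraph k H \<and> colorable P H \<longrightarrow> free_of \<F> H) \<and>
     (\<forall>H. kgraph k H \<and> free_of \<F> H \<and> card (edges H) = ex_number k (card (verts H)) \<F>
        \<longrightarrow> colorable P H)"

text \<open>The first two conjuncts are the standing assumptions under which degree-stability of
  \<open>\<F>\<close> with respect to \<open>\<H>\<close> is defined.\<close>

definition degree_stable :: "nat \<Rightarrow> hypergraph set \<Rightarrow> hypergraph set \<Rightarrow> bool" where
  "degree_stable k \<F> \<H> \<longleftrightarrow>
     turan_density k \<F> > 0 \<and>
     (\<forall>H\<in>\<H>. kgraph k H \<and> free_of \<F> H) \<and>
     (\<exists>\<epsilon>>0. \<exists>n0. \<forall>H. kgraph k H \<and> free_of \<F> H \<and> card (verts H) \<ge> n0 \<and>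
        real (min_degree H)
          \<ge> (turan_density k \<F> / fact (k - 1) - \<epsilon>) * real (card (verts H)) ^ (k - 1)
        \<longrightarrow> H \<in> \<H>)"

text \<open>The parts are the residue classes modulo \<open>l\<close> in \<open>{0..<n}\<close>, whose sizes differ by at most 1.\<close>

definition turan_graph :: "nat \<Rightarrow> nat \<Rightarrow> nat \<Rightarrow> hypergraph" where
  "turan_graph k l n =
     ({..<n}, {e. e \<subseteq> {..<n} \<and> card e = k \<and> inj_on (\<lambda>v. v mod l) e})"

text \<open>For nonempty vertex set the supremum is over a continuous image of a compact set, hence a
  maximum. Only the values of \<open>x\<close> on the vertex set matter.\<close>

definition spectral_lambda :: "nat \<Rightarrow> real \<Rightarrow> hypergraph \<Rightarrow> real" where
  "spectral_lambda k \<alpha> G =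
     Sup {fact k * (\<Sum>e\<in>edges G. \<Prod>i\<in>e. x i) | x :: nat \<Rightarrow> real.
            (\<Sum>i\<in>verts G. \<bar>x i\<bar> powr \<alpha>) = 1}"

end

theory Submission imports Defs "HOL-Analysis.Analysis" begin

text \<open>
  Put \<open>\<beta> = k - k/\<alpha>\<close> and \<open>p = k! (l choose k) / l\<^sup>k\<close>, which is the Turan density of the family. By Maclaurin's
  inequality every \<open>l\<close>-partite graph on \<open>n\<close> vertices has \<open>\<lambda>\<^sub>\<alpha> \<le> p n\<^sup>\<beta>\<close>, while the constant vector gives
  \<open>\<lambda>\<^sub>\<alpha>(T(n)) \<ge> p n\<^sup>\<beta> (1 - C/n\<^sup>2)\<close>. Let \<open>x\<close> be a nonnegative maximising vector of a free graph \<open>G\<close> with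
  \<open>\<lambda>\<^sub>\<alpha>(G) \<ge> \<lambda>\<^sub>\<alpha>(T(n))\<close>.

  If every \<open>x\<^sub>v\<^sup>\<alpha>\<close> is at least \<open>(1 - \<delta>)/n\<close>, then \<open>x\<close> is nearly constant, and the Lagrange condition
  \<open>(k - 1)! \<Sum>\<^bsub>e \<ni> v\<^esub> x\<^bsub>e - v\<^esub> = \<lambda> x\<^sub>v\<^bsup>\<alpha> - 1\<^esup>\<close> forces large minimum degree, so that \<open>G\<close> is \<open>l\<close>-partite by
  degree-stability. Otherwise some vertex is light, and deleting it multiplies \<open>\<lambda>\<^sub>\<alpha> / n\<^sup>\<beta>\<close> by at least
  \<open>1 + c/n\<close>. Iterating, one reaches either an \<open>l\<close>-partite graph with \<open>\<lambda>\<^sub>\<alpha> > p m\<^sup>\<beta>\<close> or a graph of bounded order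
  with arbitrarily large \<open>\<lambda>\<^sub>\<alpha>\<close>; both are impossible for large \<open>n\<close>.

  Among \<open>l\<close>-partite graphs, moving a vertex from a part to one that is smaller by at least two strictly increases the
  maximum, because \<open>(y, n) \<mapsto> n (y/n)\<^sup>\<alpha>\<close> is jointly convex and elementary symmetric polynomials are
  Schur-concave. Hence the balanced complete \<open>l\<close>-partite graph is the unique maximiser.
\<close>

section \<open>Elementary symmetric sums\<close>

definition esym :: "nat \<Rightarrow> 'i set \<Rightarrow> ('i \<Rightarrow> real) \<Rightarrow> real" where
  "esym k L y = (\<Sum>K\<in>{K. K \<subseteq> L \<and> card K = k}. \<Prod>i\<in>K. y i)"

lemma finite_card_subsets: "finite L \<Longrightarrow> finite {K. K \<subseteq> L \<and> card K = k}"
  by (rule finite_subset[of _ "Pow L"]) auto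

lemma esym_0: "finite L \<Longrightarrow> esym 0 L y = 1"
proof -
  assume "finite L"
  then have "{K. K \<subseteq> L \<and> card K = 0} = {{}}"
    using finite_subset by fastforce
  then show ?thesis by (simp add: esym_def)
qed

lemma esym_empty_Suc: "esym (Suc k) {} y = 0"
proof -
  have "{K::'a set. K \<subseteq> {} \<and> card K = Suc k} = {}" by auto
  then show ?thesis unfolding esym_def by simp
qed

lemma inj_on_insert_subsets: "i \<notin> M \<Longrightarrow> inj_on (insert i) {K. K \<subseteq> M \<and> card K = k}"
proof (rule inj_onI)
  fix K K' assume i: "i \<notin> M" and K: "K \<in> {K. K \<subseteq> M \<and> card K = k}" "K' \<in> {K. K \<subseteq> M \<and> card K = k}"
    and eq: "insert i K = insert i K'"
  have "i \<notin> K" "i \<notin> K'" using i K by auto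
  then show "K = K'" using eq by (rule insert_ident[THEN iffD1])
qed

text \<open>Splitting the index sets by whether they contain \<open>i\<close> gives a Pascal-type
  recursion. It drives the induction for Maclaurin's inequality and the expansion in two
  variables.\<close>

lemma esym_insert:
  assumes L: "finite L" "i \<notin> L"
  shows "esym (Suc k) (insert i L) y = esym (Suc k) L y + y i * esym k L y"
proof -
  let ?A = "{K. K \<subseteq> L \<and> card K = Suc k}" and ?B = "{K. K \<subseteq> L \<and> card K = k}"
  have fin: "finite K" if "K \<subseteq> insert i L" for K
    using that L finite_subset by auto
  have "K \<in> insert i ` ?B" if "K \<subseteq> insert i L" "card K = Suc k" "i \<in> K" for K
  proof
    show "K = insert i (K - {i})" using that by auto
    show "K - {i} \<in> ?B" using that fin by auto
  qed
  then have "{K. K \<subseteq> insert i L \<and> card K = Suc k} \<subseteq> ?A \<union> insert i ` ?B"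
    by blast
  moreover have "card (insert i K) = Suc k" if "K \<subseteq> L" "card K = k" for K
    using that L finite_subset[of K L] by (auto simp: card_insert_if)
  then have "?A \<union> insert i ` ?B \<subseteq> {K. K \<subseteq> insert i L \<and> card K = Suc k}"
    by blast
  ultimately have eq: "{K. K \<subseteq> insert i L \<and> card K = Suc k} = ?A \<union> insert i ` ?B"
    by (rule subset_antisym)
  have inj: "inj_on (insert i) ?B"
    using L(2) by (rule inj_on_insert_subsets)
  have "esym (Suc k) (insert i L) y = (\<Sum>K\<in>?A. \<Prod>j\<in>K. y j) + (\<Sum>K\<in>insert i ` ?B. \<Prod>j\<in>K. y j)"
    unfolding esym_def eq
    by (rule sum.union_disjoint) (use L finite_card_subsets in auto)
  also have "(\<Sum>K\<in>insert i ` ?B. \<Prod>j\<in>K. y j) = (\<Sum>K\<in>?B. \<Prod>j\<in>insert i K. y j)"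
    using inj by (simp add: sum.reindex)
  also have "\<dots> = (\<Sum>K\<in>?B. y i * (\<Prod>j\<in>K. y j))"
  proof (rule sum.cong[OF refl])
    fix K assume "K \<in> ?B"
    then have "finite K" "i \<notin> K" using L finite_subset[of K L] by auto
    then show "(\<Prod>j\<in>insert i K. y j) = y i * (\<Prod>j\<in>K. y j)" by simp
  qed
  finally show ?thesis by (simp add: esym_def sum_distrib_left)
qed

lemma esym_cong: "(\<And>i. i \<in> L \<Longrightarrow> y i = z i) \<Longrightarrow> esym k L y = esym k L z"
  unfolding esym_def by (intro sum.cong prod.cong refl) auto

lemma esym_pos:
  assumes "finite L" "R \<subseteq> L" "k \<le> card R"
    and "\<And>i. i \<in> L \<Longrightarrow> 0 \<le> y i" "\<And>i. i \<in> R \<Longrightarrow> 0 < y i"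
  shows "0 < esym k L y"
proof -
  obtain K where K: "K \<subseteq> R" "card K = k"
    using assms(3) obtain_subset_with_card_n by metis
  show ?thesis unfolding esym_def
  proof (rule sum_pos2[where i = K])
    show "finite {K. K \<subseteq> L \<and> card K = k}" using assms(1) finite_card_subsets by auto
    show "K \<in> {K. K \<subseteq> L \<and> card K = k}" using K assms by auto
    show "0 < (\<Prod>i\<in>K. y i)" using K assms by (intro prod_pos) auto
  qed (use assms in \<open>auto intro!: prod_nonneg\<close>)
qed

text \<open>The tangent of a convex power lies below its graph. Passing to the next exponent loses
  exactly \<open>real (Suc k) * a ^ k * (b - a)\<^sup>2\<close>.\<close>

lemma power_tangent:
  fixes a b :: real
  assumes "0 \<le> a" "0 \<le> b"
  shows "a ^ Suc k + real (Suc k) * a ^ k * (b - a) \<le> b ^ Suc k"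
proof (induction k)
  case (Suc k)
  have "0 \<le> real (Suc k) * a ^ k * (b - a)\<^sup>2" using assms by simp
  then have "a ^ Suc (Suc k) + real (Suc (Suc k)) * a ^ Suc k * (b - a)
      \<le> b * (a ^ Suc k + real (Suc k) * a ^ k * (b - a))"
    by (simp add: algebra_simps power2_eq_square)
  also have "\<dots> \<le> b * b ^ Suc k" using Suc assms by (intro mult_left_mono) auto
  finally show ?case by simp
qed simp

text \<open>Induction on the number of variables. The bounds of orders \<open>Suc j\<close> and
  \<open>j\<close> for the old variables, with mean \<open>a\<close>, combine into the tangent of
  the power \<open>Suc j\<close> at \<open>a\<close>, evaluated at the new mean \<open>b\<close>;
  convexity finishes.\<close>

lemma maclaurin_esym:
  assumes "finite L" "\<And>i. i \<in> L \<Longrightarrow> 0 \<le> y i"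
  shows "esym k L y \<le> real (card L choose k) * ((\<Sum>i\<in>L. y i) / real (card L)) ^ k"
  using assms
proof (induction L arbitrary: k rule: finite_induct)
  case empty
  show ?case by (cases k) (simp_all add: esym_0 esym_empty_Suc)
next
  case (insert i L)
  show ?case
  proof (cases k)
    case 0
    then show ?thesis using insert by (simp add: esym_0)
  next
    case (Suc j)
    define l where "l = card L"
    define a where "a = (\<Sum>i\<in>L. y i) / real l"
    define b where "b = (\<Sum>i\<in>insert i L. y i) / real (Suc l)"
    have sum_L: "(\<Sum>i\<in>L. y i) = real l * a"
      using insert.hyps by (cases "L = {}") (auto simp: a_def l_def)
    have y0: "0 \<le> y i" using insert.prems by simp
    have a0: "0 \<le> a" using insert.prems by (auto simp: a_def intro!: divide_nonneg_nonneg sum_nonneg)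
    have b0: "0 \<le> b" using insert.prems unfolding b_def
      by (intro divide_nonneg_nonneg sum_nonneg) auto
    \<comment> \<open>Adding the variable \<open>y i\<close> moves the mean by its excess over
      \<open>a\<close>, divided by the new number of variables.\<close>
    have ba: "real (Suc l) * (b - a) = y i - a"
      using insert.hyps by (simp add: b_def sum_L field_simps)
    have "real (Suc l * (l choose j)) = real ((Suc l choose Suc j) * Suc j)"
      by (simp only: Suc_times_binomial_eq mult.commute)
    then have "real (Suc l) * (real (l choose j) * (y i - a))
        = real (Suc l) * (real (Suc l choose Suc j) * real (Suc j) * (b - a))"
      unfolding ba[symmetric] of_nat_mult by algebra
    then have bin: "real (l choose j) * (y i - a) = real (Suc l choose Suc j) * real (Suc j) * (b - a)"
      by simp
    have "esym k (insert i L) y = esym (Suc j) L y + y i * esym j L y"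
      using insert.hyps by (simp add: Suc esym_insert)
    also have "\<dots> \<le> real (l choose Suc j) * a ^ Suc j + y i * (real (l choose j) * a ^ j)"
      using insert.IH insert.prems y0 unfolding l_def a_def
      by (intro add_mono mult_left_mono) (simp_all del: power_Suc binomial_Suc_Suc)
    also have "\<dots> = real (Suc l choose Suc j) * a ^ Suc j + (real (l choose j) * (y i - a)) * a ^ j"
      by (simp add: algebra_simps)
    also have "\<dots> = real (Suc l choose Suc j) * (a ^ Suc j + real (Suc j) * a ^ j * (b - a))"
      unfolding bin by (simp add: algebra_simps)
    also have "\<dots> \<le> real (Suc l choose Suc j) * b ^ Suc j"
      using power_tangent[OF a0 b0] by (intro mult_left_mono) auto
    finally show ?thesis
      using insert.hyps Suc by (simp add: b_def l_def)
  qed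
qed

text \<open>Only the terms of order at most one in the \<open>a i\<close> are kept; the others are
  nonnegative. The extra factor \<open>q\<close> on both sides avoids the exponent
  \<open>card K - 1\<close>.\<close>

lemma prod_add_ge:
  fixes a :: "'i \<Rightarrow> real"
  assumes "finite K" "0 \<le> q" "\<And>i. i \<in> K \<Longrightarrow> 0 \<le> a i"
  shows "q * q ^ card K + q ^ card K * (\<Sum>i\<in>K. a i) \<le> q * (\<Prod>i\<in>K. q + a i)"
  using assms
proof (induction K rule: finite_induct)
  case (insert i K)
  have IH: "q * q ^ card K + q ^ card K * (\<Sum>i\<in>K. a i) \<le> q * (\<Prod>i\<in>K. q + a i)"
    using insert by auto
  have nn: "0 \<le> a i * (q ^ card K * (\<Sum>i\<in>K. a i))"
    using insert.prems by (intro mult_nonneg_nonneg sum_nonneg) auto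
  have "q * q ^ card (insert i K) + q ^ card (insert i K) * (\<Sum>i\<in>insert i K. a i)
      \<le> (q + a i) * (q * q ^ card K + q ^ card K * (\<Sum>i\<in>K. a i))"
    using insert.hyps nn by (simp add: algebra_simps)
  also have "\<dots> \<le> (q + a i) * (q * (\<Prod>i\<in>K. q + a i))"
    using IH insert.prems by (intro mult_left_mono) auto
  finally show ?case using insert.hyps by (simp add: algebra_simps)
qed simp

text \<open>Double counting: each index lies in \<open>(card L - 1) choose j\<close> of the
  subsets.\<close>

lemma sum_subsets_sum:
  fixes a :: "'i \<Rightarrow> real"
  assumes "finite L"
  shows "(\<Sum>K\<in>{K. K \<subseteq> L \<and> card K = Suc j}. \<Sum>i\<in>K. a i)
    = real ((card L - 1) choose j) * (\<Sum>i\<in>L. a i)"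
proof -
  let ?S = "{K. K \<subseteq> L \<and> card K = Suc j}"
  have fS: "finite ?S" using assms by (rule finite_card_subsets)
  have "(\<Sum>K\<in>?S. \<Sum>i\<in>K. a i) = (\<Sum>K\<in>?S. \<Sum>i\<in>{i\<in>L. i \<in> K}. a i)"
    by (intro sum.cong refl) auto
  also have "\<dots> = (\<Sum>i\<in>L. \<Sum>K\<in>{K\<in>?S. i \<in> K}. a i)"
    using fS assms by (rule sum.swap_restrict)
  also have "\<dots> = (\<Sum>i\<in>L. real ((card L - 1) choose j) * a i)"
  proof (rule sum.cong[OF refl])
    fix i assume i: "i \<in> L"
    let ?B = "{K. K \<subseteq> L - {i} \<and> card K = j}"
    have "K \<in> insert i ` ?B" if "K \<in> ?S" "i \<in> K" for K
    proof
      show "K = insert i (K - {i})" using that by auto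
      show "K - {i} \<in> ?B" using that by auto
    qed
    moreover have "insert i K \<in> ?S" if "K \<in> ?B" for K
    proof -
      have "finite K" using that assms finite_subset[of K L] by auto
      moreover have "i \<notin> K" using that by auto
      ultimately show ?thesis using that i by auto
    qed
    ultimately have "{K\<in>?S. i \<in> K} = insert i ` ?B" by blast
    moreover have "inj_on (insert i) ?B" by (rule inj_on_insert_subsets) simp
    ultimately have "card {K\<in>?S. i \<in> K} = card ?B" by (simp only: card_image)
    also have "\<dots> = (card L - 1) choose j"
      using assms i by (simp add: n_subsets)
    finally show "(\<Sum>K\<in>{K\<in>?S. i \<in> K}. a i) = real ((card L - 1) choose j) * a i" by simp
  qed
  finally show ?thesis by (simp add: sum_distrib_left)
qed

text \<open>The first-order terms of the deviations from the mean cancel, which makes the error quadratic.\<close>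

lemma esym_near_const_ge:
  fixes a :: "'i \<Rightarrow> real"
  assumes L: "finite L" "card L = l" "0 < l" and q: "0 < q" and a: "\<And>i. i \<in> L \<Longrightarrow> 0 \<le> a i"
    and r: "(\<Sum>i\<in>L. a i) \<le> real l" and n: "n = real l * q + (\<Sum>i\<in>L. a i)"
  shows "real (l choose Suc j) * (n / real l) ^ Suc j * (1 - (real j * real l / n)\<^sup>2)
    \<le> esym (Suc j) L (\<lambda>i. q + a i)"
proof -
  \<comment> \<open>Here \<open>s\<close> is the mean deviation and \<open>m\<close> the mean of the
    variables, so that \<open>m = q + s\<close>.\<close>
  define s where "s = (\<Sum>i\<in>L. a i) / real l"
  define m where "m = n / real l"
  have s0: "0 \<le> s" using a unfolding s_def by (intro divide_nonneg_nonneg sum_nonneg) auto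
  have s1: "s \<le> 1" using r L by (simp add: s_def)
  have m: "m = q + s" using L n by (simp add: m_def s_def field_simps)
  have mpos: "0 < m" using m q s0 by simp
  have bin: "real l * real ((l - 1) choose j) = real (Suc j) * real (l choose Suc j)"
    using L Suc_times_binomial_eq[of "l - 1" j]
    by (metis One_nat_def Suc_pred' diff_Suc_1 mult.commute of_nat_mult)
  let ?S = "{K. K \<subseteq> L \<and> card K = Suc j}"
  have "q * (real (l choose Suc j) * (q ^ Suc j + q ^ j * (real (Suc j) * s)))
      = real (l choose Suc j) * (q * q ^ Suc j) + q ^ Suc j * (real l * real ((l - 1) choose j) * s)"
    unfolding bin by (simp add: algebra_simps)
  also have "\<dots> = real (l choose Suc j) * (q * q ^ Suc j) + q ^ Suc j * (real ((l - 1) choose j) * (\<Sum>i\<in>L. a i))"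
    using L by (simp add: s_def)
  also have "\<dots> = (\<Sum>K\<in>?S. q * q ^ Suc j + q ^ Suc j * (\<Sum>i\<in>K. a i))"
    using sum_subsets_sum[OF L(1), where j = j and a = a] L n_subsets[OF L(1), of "Suc j"]
    by (simp add: sum.distrib sum_distrib_left[symmetric])
  also have "\<dots> \<le> (\<Sum>K\<in>?S. q * (\<Prod>i\<in>K. q + a i))"
  proof (rule sum_mono)
    fix K assume K: "K \<in> ?S"
    then have "finite K" using L finite_subset by auto
    from prod_add_ge[OF this, of q a] show "q * q ^ Suc j + q ^ Suc j * (\<Sum>i\<in>K. a i) \<le> q * (\<Prod>i\<in>K. q + a i)"
      using K q a by auto
  qed
  finally have low: "real (l choose Suc j) * (q ^ Suc j + q ^ j * (real (Suc j) * s))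
      \<le> esym (Suc j) L (\<lambda>i. q + a i)"
    using q by (simp add: esym_def sum_distrib_left[symmetric])
  have bern: "m ^ j * (1 - real j * s / m) \<le> q ^ j"
  proof -
    have "1 - real j * s / m \<le> (1 + (- (s / m))) ^ j"
      using Bernoulli_inequality[of "- (s / m)" j] m mpos q by (simp add: field_simps)
    then have "m ^ j * (1 - real j * s / m) \<le> m ^ j * (1 + (- (s / m))) ^ j"
      using mpos by (intro mult_left_mono) auto
    also have "\<dots> = (m * (1 + (- (s / m)))) ^ j" by (simp add: power_mult_distrib)
    also have "m * (1 + (- (s / m))) = q" using mpos m by (simp add: field_simps)
    finally show ?thesis .
  qed
  have "m ^ Suc j * (1 - (real j * real l / n)\<^sup>2) = m ^ Suc j * (1 - (real j / m)\<^sup>2)"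
    using L mpos by (simp add: m_def)
  also have "\<dots> \<le> m ^ Suc j * (1 - (real j * s / m)\<^sup>2)"
  proof (intro mult_left_mono diff_left_mono power_mono divide_right_mono)
    show "real j * s \<le> real j" using s1 by (simp add: mult_left_le)
  qed (use mpos s0 in auto)
  \<comment> \<open>A difference of squares: the first factor is the Bernoulli lower bound for
    \<open>q ^ j\<close>, and the second carries the first-order gain, because
    \<open>m + real j * s = q + real (Suc j) * s\<close>.\<close>
  also have "\<dots> = (m ^ j * (1 - real j * s / m)) * (m + real j * s)"
    using mpos by (simp add: field_simps power2_eq_square)
  also have "\<dots> \<le> q ^ j * (m + real j * s)"
    using bern mpos s0 by (intro mult_right_mono) auto
  also have "\<dots> = q ^ Suc j + q ^ j * (real (Suc j) * s)"
    by (simp add: m algebra_simps)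
  finally show ?thesis
    using low unfolding m_def[symmetric]
    by (smt (verit) mult.assoc mult_left_mono of_nat_0_le_iff)
qed

section \<open>Edge polynomials of complete partite graphs\<close>

definition partite_edges :: "nat \<Rightarrow> 'a set \<Rightarrow> ('a \<Rightarrow> 'i) \<Rightarrow> 'a set set" where
  "partite_edges k V \<phi> = {e. e \<subseteq> V \<and> card e = k \<and> inj_on \<phi> e}"

lemma finite_partite_edges: "finite V \<Longrightarrow> finite (partite_edges k V \<phi>)"
  by (rule finite_subset[of _ "Pow V"]) (auto simp: partite_edges_def)

text \<open>Expanding the product of the part totals over a color set \<open>K\<close> chooses one
  vertex from each part in \<open>K\<close>, which is the same as an edge with color set
  \<open>K\<close>. Hence the edge polynomial depends on \<open>x\<close> only through the part
  totals.\<close>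

lemma sum_partite_edges:
  fixes x :: "'a \<Rightarrow> real"
  assumes V: "finite V" and L: "finite L" and \<phi>: "\<phi> ` V \<subseteq> L"
  shows "(\<Sum>e\<in>partite_edges k V \<phi>. \<Prod>v\<in>e. x v) = esym k L (\<lambda>i. \<Sum>v\<in>{v\<in>V. \<phi> v = i}. x v)"
proof -
  let ?P = "\<lambda>i. {v\<in>V. \<phi> v = i}" and ?S = "{K. K \<subseteq> L \<and> card K = k}"
  let ?E = "partite_edges k V \<phi>"
  have img: "(\<lambda>e. \<phi> ` e) ` ?E \<subseteq> ?S"
    using \<phi> by (auto simp: partite_edges_def card_image)
  have "esym k L (\<lambda>i. \<Sum>v\<in>?P i. x v) = (\<Sum>K\<in>?S. \<Sum>e\<in>{e\<in>?E. \<phi> ` e = K}. \<Prod>v\<in>e. x v)"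
    unfolding esym_def
  proof (rule sum.cong[OF refl])
    fix K assume K: "K \<in> ?S"
    then have fK: "finite K" using L finite_subset by auto
    have "(\<Prod>i\<in>K. \<Sum>v\<in>?P i. x v) = (\<Sum>g\<in>PiE K ?P. \<Prod>i\<in>K. x (g i))"
      using fK V by (subst prod_sum_PiE) auto
    also have "\<dots> = (\<Sum>e\<in>{e\<in>?E. \<phi> ` e = K}. \<Prod>v\<in>e. x v)"
    \<comment> \<open>A transversal \<open>g\<close> corresponds to its image; conversely, an edge
      yields the inverse of the coloring on it.\<close>
    proof (rule sum.reindex_bij_witness[where j = "\<lambda>g. g ` K" and i = "\<lambda>e. restrict (the_inv_into e \<phi>) K"])
      fix g assume g: "g \<in> PiE K ?P"
      have \<phi>g: "\<phi> (g i) = i" if "i \<in> K" for i using g that by auto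
      have ig: "inj_on g K" by (metis \<phi>g inj_onI)
      have i\<phi>: "inj_on \<phi> (g ` K)" using \<phi>g by (auto intro!: inj_onI)
      show "g ` K \<in> {e\<in>?E. \<phi> ` e = K}"
        using g K i\<phi> ig \<phi>g by (auto simp: partite_edges_def card_image image_iff)
      show "restrict (the_inv_into (g ` K) \<phi>) K = g"
      proof
        fix i show "restrict (the_inv_into (g ` K) \<phi>) K i = g i"
          using g \<phi>g i\<phi> by (cases "i \<in> K") (auto intro!: the_inv_into_f_eq)
      qed
      show "(\<Prod>v\<in>g ` K. x v) = (\<Prod>i\<in>K. x (g i))"
        using ig by (simp add: prod.reindex)
    next
      fix e assume e: "e \<in> {e\<in>?E. \<phi> ` e = K}"
      then have i\<phi>: "inj_on \<phi> e" and eK: "\<phi> ` e = K" and eV: "e \<subseteq> V" by (auto simp: partite_edges_def)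
      show "restrict (the_inv_into e \<phi>) K ` K = e"
        using the_inv_into_onto[OF i\<phi>] eK by (simp add: image_restrict_eq)
      show "restrict (the_inv_into e \<phi>) K \<in> PiE K ?P"
        using i\<phi> eK eV the_inv_into_into[OF i\<phi> _ subset_refl] f_the_inv_into_f[OF i\<phi>] by auto
    qed
    finally show "(\<Prod>i\<in>K. \<Sum>v\<in>?P i. x v) = (\<Sum>e\<in>{e\<in>?E. \<phi> ` e = K}. \<Prod>v\<in>e. x v)" .
  qed
  also have "\<dots> = (\<Sum>e\<in>?E. \<Prod>v\<in>e. x v)"
    using finite_partite_edges[OF V] finite_card_subsets[OF L] img by (rule sum.group)
  finally show ?thesis by simp
qed

section \<open>Convexity of powers\<close>

text \<open>The mean value theorem on either side of \<open>s\<close>, with the strictly increasing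
  derivative. The derivative is used only at positive points, so \<open>t = 0\<close> is computed
  directly.\<close>

lemma powr_tangent_strict:
  fixes s t \<alpha> :: real
  assumes \<alpha>: "1 < \<alpha>" and s: "0 < s" and t: "0 \<le> t" "t \<noteq> s"
  shows "s powr \<alpha> + \<alpha> * s powr (\<alpha> - 1) * (t - s) < t powr \<alpha>"
proof (cases "t = 0")
  case True
  have "s powr \<alpha> = s powr (\<alpha> - 1) * s"
    using s by (simp add: powr_diff)
  then have "s powr \<alpha> + \<alpha> * s powr (\<alpha> - 1) * (t - s) = - ((\<alpha> - 1) * (s powr (\<alpha> - 1) * s))"
    using True by (simp add: algebra_simps)
  also have "\<dots> < 0" using s \<alpha> by simp
  finally show ?thesis using True by simp
next
  case False
  then have t0: "0 < t" using t by simp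
  have D: "((\<lambda>u. u powr \<alpha>) has_real_derivative \<alpha> * z powr (\<alpha> - 1)) (at z)" if "0 < z" for z
    using that by (auto intro!: derivative_eq_intros)
  show ?thesis
  proof (cases "s < t")
    case True
    obtain z where z: "s < z" "z < t" "t powr \<alpha> - s powr \<alpha> = (t - s) * (\<alpha> * z powr (\<alpha> - 1))"
      using MVT2[OF True, of "\<lambda>u. u powr \<alpha>" "\<lambda>z. \<alpha> * z powr (\<alpha> - 1)"] D s by auto
    have "s powr (\<alpha> - 1) < z powr (\<alpha> - 1)" using z s \<alpha> by (intro powr_less_mono2) auto
    then have "(t - s) * (\<alpha> * s powr (\<alpha> - 1)) < (t - s) * (\<alpha> * z powr (\<alpha> - 1))"
      using True \<alpha> by simp
    then show ?thesis using z(3) by (simp add: algebra_simps)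
  next
    case False
    then have ts: "t < s" using t by simp
    obtain z where z: "t < z" "z < s" "s powr \<alpha> - t powr \<alpha> = (s - t) * (\<alpha> * z powr (\<alpha> - 1))"
      using MVT2[OF ts, of "\<lambda>u. u powr \<alpha>" "\<lambda>z. \<alpha> * z powr (\<alpha> - 1)"] D t0 by auto
    have "z powr (\<alpha> - 1) < s powr (\<alpha> - 1)" using z t0 \<alpha> by (intro powr_less_mono2) auto
    then have "(s - t) * (\<alpha> * z powr (\<alpha> - 1)) < (s - t) * (\<alpha> * s powr (\<alpha> - 1))"
      using ts \<alpha> by simp
    then show ?thesis using z(3) by (simp add: algebra_simps)
  qed
qed

lemma powr_tangent:
  fixes s t \<alpha> :: real
  assumes "1 < \<alpha>" "0 < s" "0 \<le> t"
  shows "s powr \<alpha> + \<alpha> * s powr (\<alpha> - 1) * (t - s) \<le> t powr \<alpha>"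
  using powr_tangent_strict[of \<alpha> s t] assms by (cases "t = s") auto

text \<open>Jensen's inequality: in the sum of the tangent inequalities at the mean the linear terms
  cancel. If the mean is 0, which includes \<open>card A = 0\<close> by the convention for division,
  the left side vanishes.\<close>

lemma power_mean:
  fixes x :: "'a \<Rightarrow> real"
  assumes \<alpha>: "1 < \<alpha>" and x: "\<And>i. i \<in> A \<Longrightarrow> 0 \<le> x i"
  shows "real (card A) * ((\<Sum>i\<in>A. x i) / real (card A)) powr \<alpha> \<le> (\<Sum>i\<in>A. x i powr \<alpha>)"
proof (cases "(\<Sum>i\<in>A. x i) / real (card A) = 0")
  case True
  then show ?thesis by (simp only: True powr_zero_eq_one) (simp add: sum_nonneg)
next
  case False
  define s where "s = (\<Sum>i\<in>A. x i) / real (card A)"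
  have s: "0 < s" using False x unfolding s_def
    by (metis divide_nonneg_nonneg less_eq_real_def of_nat_0_le_iff sum_nonneg)
  have cs: "real (card A) * s = (\<Sum>i\<in>A. x i)" using s by (cases "card A = 0") (auto simp: s_def)
  have "real (card A) * s powr \<alpha>
      = (\<Sum>i\<in>A. s powr \<alpha> + \<alpha> * s powr (\<alpha> - 1) * (x i - s))"
    using cs by (simp add: sum.distrib sum_distrib_left[symmetric] sum_subtractf)
  also have "\<dots> \<le> (\<Sum>i\<in>A. x i powr \<alpha>)"
    using \<alpha> s x by (intro sum_mono powr_tangent) auto
  finally show ?thesis by (simp add: s_def)
qed

text \<open>This is the joint convexity of \<open>(y, n) \<mapsto> n (y/n)\<^sup>\<alpha>\<close>, written in terms of \<open>a = y/n\<close>.\<close>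

lemma powr_weighted_mean:
  fixes a b u w \<alpha> :: real
  assumes \<alpha>: "1 < \<alpha>" and ab: "0 \<le> a" "0 \<le> b" and uw: "0 \<le> u" "0 \<le> w" "0 < u + w"
  shows "(u + w) * ((u * a + w * b) / (u + w)) powr \<alpha> \<le> u * a powr \<alpha> + w * b powr \<alpha>"
    and "0 < u \<Longrightarrow> 0 < w \<Longrightarrow> a \<noteq> b \<Longrightarrow>
      (u + w) * ((u * a + w * b) / (u + w)) powr \<alpha> < u * a powr \<alpha> + w * b powr \<alpha>"
proof -
  define s where "s = (u * a + w * b) / (u + w)"
  have us: "(u + w) * s = u * a + w * b" using uw by (simp add: s_def)
  have s0: "0 \<le> s" using uw ab by (simp add: s_def)
  \<comment> \<open>The linear terms cancel because \<open>s\<close> is the weighted mean of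
    \<open>a\<close> and \<open>b\<close>; both tangents are taken at \<open>s\<close>.\<close>
  have eq: "(u + w) * s powr \<alpha> = u * (s powr \<alpha> + \<alpha> * s powr (\<alpha> - 1) * (a - s))
      + w * (s powr \<alpha> + \<alpha> * s powr (\<alpha> - 1) * (b - s))"
    using us by algebra
  have "(u + w) * s powr \<alpha> \<le> u * a powr \<alpha> + w * b powr \<alpha>"
  proof (cases "s = 0")
    case True
    then show ?thesis using uw by simp
  next
    case False
    then show ?thesis unfolding eq using \<alpha> s0 ab uw
      by (intro add_mono mult_left_mono powr_tangent) auto
  qed
  then show "(u + w) * ((u * a + w * b) / (u + w)) powr \<alpha> \<le> u * a powr \<alpha> + w * b powr \<alpha>"
    by (simp add: s_def)
  assume pos: "0 < u" "0 < w" "a \<noteq> b"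
  have "s \<noteq> a"
  proof
    assume "s = a"
    then have "w * a = w * b" using us by (simp add: algebra_simps)
    then show False using pos by simp
  qed
  have s: "0 < s"
  proof -
    have "0 < a \<or> 0 < b" using pos ab by auto
    then have "0 < u * a + w * b"
      using pos ab by (auto intro: add_pos_nonneg add_nonneg_pos)
    then show ?thesis using uw by (simp add: s_def)
  qed
  have "(u + w) * s powr \<alpha> < u * a powr \<alpha> + w * b powr \<alpha>"
    unfolding eq
  proof (rule add_less_le_mono)
    show "u * (s powr \<alpha> + \<alpha> * s powr (\<alpha> - 1) * (a - s)) < u * a powr \<alpha>"
      using powr_tangent_strict[OF \<alpha> s ab(1)] \<open>s \<noteq> a\<close> pos by simp
    show "w * (s powr \<alpha> + \<alpha> * s powr (\<alpha> - 1) * (b - s)) \<le> w * b powr \<alpha>"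
      using powr_tangent[OF \<alpha> s ab(2)] pos by (intro mult_left_mono) auto
  qed
  then show "(u + w) * ((u * a + w * b) / (u + w)) powr \<alpha> < u * a powr \<alpha> + w * b powr \<alpha>"
    by (simp add: s_def)
qed

section \<open>Maximising vectors and the Lagrange condition\<close>

definition edge_sum :: "nat set set \<Rightarrow> (nat \<Rightarrow> real) \<Rightarrow> real" where
  "edge_sum E x = (\<Sum>e\<in>E. \<Prod>i\<in>e. x i)"

lemma kgraph_finite_edges: "kgraph k G \<Longrightarrow> finite (edges G)"
  by (rule finite_subset[of _ "Pow (verts G)"]) (auto simp: kgraph_def)

lemma kgraph_finite_edge: "kgraph k G \<Longrightarrow> e \<in> edges G \<Longrightarrow> finite e"
  by (meson kgraph_def finite_subset)

lemma edge_sum_nonneg: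
  assumes "kgraph k G" "\<And>i. i \<in> verts G \<Longrightarrow> 0 \<le> x i"
  shows "0 \<le> edge_sum (edges G) x"
  unfolding edge_sum_def using assms by (intro sum_nonneg prod_nonneg) (auto simp: kgraph_def)

lemma edge_sum_cong:
  assumes "kgraph k G" "\<And>i. i \<in> verts G \<Longrightarrow> x i = y i"
  shows "edge_sum (edges G) x = edge_sum (edges G) y"
  unfolding edge_sum_def using assms by (intro sum.cong prod.cong refl) (auto simp: kgraph_def)

lemma edge_sum_scale:
  assumes "kgraph k G"
  shows "edge_sum (edges G) (\<lambda>i. c * x i) = c ^ k * edge_sum (edges G) x"
  unfolding edge_sum_def sum_distrib_left
  using assms by (intro sum.cong refl) (auto simp: kgraph_def prod.distrib)

lemma edge_sum_le_abs: "edge_sum E x \<le> edge_sum E (\<lambda>i. \<bar>x i\<bar>)"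
  unfolding edge_sum_def by (intro sum_mono) (metis abs_ge_self abs_prod)

lemma unit_coord_le_1:
  fixes x :: "'a \<Rightarrow> real"
  assumes "finite V" "0 < \<alpha>" "(\<Sum>i\<in>V. \<bar>x i\<bar> powr \<alpha>) = 1" "i \<in> V"
  shows "\<bar>x i\<bar> \<le> 1"
proof -
  have "\<bar>x i\<bar> powr \<alpha> \<le> (\<Sum>i\<in>V. \<bar>x i\<bar> powr \<alpha>)"
    using assms by (intro member_le_sum) auto
  then have "\<bar>x i\<bar> powr \<alpha> \<le> 1 powr \<alpha>" using assms by simp
  then show ?thesis using assms(2) powr_less_mono2[of \<alpha> 1 "\<bar>x i\<bar>"]
    by (smt (verit))
qed

text \<open>The coordinates of a unit vector are at most 1 in absolute value, so each edge
  contributes at most 1. This makes the supremum in \<open>spectral_lambda\<close> finite.\<close>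

lemma edge_sum_unit_le_card:
  assumes G: "kgraph k G" and "0 < \<alpha>" "(\<Sum>i\<in>verts G. \<bar>x i\<bar> powr \<alpha>) = 1"
  shows "edge_sum (edges G) x \<le> real (card (edges G))"
proof -
  have "edge_sum (edges G) (\<lambda>i. \<bar>x i\<bar>) \<le> (\<Sum>e\<in>edges G. 1)"
    unfolding edge_sum_def
  proof (intro sum_mono prod_le_1)
    fix e i assume "e \<in> edges G" "i \<in> e"
    then have "i \<in> verts G" using G by (auto simp: kgraph_def)
    then show "0 \<le> \<bar>x i\<bar> \<and> \<bar>x i\<bar> \<le> 1"
      using unit_coord_le_1 assms by (auto simp: kgraph_def)
  qed
  then show ?thesis using edge_sum_le_abs[of "edges G" x] by simp
qed

lemma spectral_lambda_eq:
  "spectral_lambda k \<alpha> G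
    = Sup {fact k * edge_sum (edges G) x | x. (\<Sum>i\<in>verts G. \<bar>x i\<bar> powr \<alpha>) = 1}"
  by (simp add: spectral_lambda_def edge_sum_def)

lemma unit_le_spectral_lambda:
  assumes G: "kgraph k G" and \<alpha>: "0 < \<alpha>" and x: "(\<Sum>i\<in>verts G. \<bar>x i\<bar> powr \<alpha>) = 1"
  shows "fact k * edge_sum (edges G) x \<le> spectral_lambda k \<alpha> G"
  unfolding spectral_lambda_eq
proof (rule cSup_upper)
  show "fact k * edge_sum (edges G) x
      \<in> {fact k * edge_sum (edges G) x | x. (\<Sum>i\<in>verts G. \<bar>x i\<bar> powr \<alpha>) = 1}" using x by blast
  show "bdd_above {fact k * edge_sum (edges G) x | x. (\<Sum>i\<in>verts G. \<bar>x i\<bar> powr \<alpha>) = 1}"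
    by (rule bdd_aboveI[where M = "fact k * real (card (edges G))"])
      (use edge_sum_unit_le_card[OF G \<alpha>] in auto)
qed

text \<open>A continuous function on a compact set of nonnegative vectors has a maximum, and passing
  to absolute values never lowers the edge polynomial, so this maximum is the supremum over all unit
  vectors.\<close>

lemma spectral_lambda_attained:
  assumes G: "kgraph k G" and ne: "verts G \<noteq> {}" and \<alpha>: "0 < \<alpha>"
  obtains x where "\<And>i. 0 \<le> x i" "(\<Sum>i\<in>verts G. x i powr \<alpha>) = 1"
    "spectral_lambda k \<alpha> G = fact k * edge_sum (edges G) x"
proof -
  let ?V = "verts G"
  have fV: "finite ?V" using G by (simp add: kgraph_def)
  \<comment> \<open>Coordinates outside the vertex set are pinned to 0, so this infinite product is
    compact by Tychonoff's theorem.\<close>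
  define B :: "(nat \<Rightarrow> real) set" where "B = PiE UNIV (\<lambda>i. if i \<in> ?V then {0..1} else {0})"
  define S where "S = {x \<in> B. (\<Sum>i\<in>?V. x i powr \<alpha>) = 1}"
  have Bnn: "0 \<le> x i" if "x \<in> B" for x i
    using that unfolding B_def by (auto simp: PiE_iff split: if_splits)
  have "compactin (product_topology (\<lambda>i. euclidean) UNIV) B"
    unfolding B_def by (subst compactin_PiE) auto
  then have cB: "compact B"
    by (simp add: euclidean_product_topology)
  have cont_norm: "continuous_on B (\<lambda>x. \<Sum>i\<in>?V. x i powr \<alpha>)"
  proof (intro continuous_on_sum continuous_on_powr')
    fix i show "continuous_on B (\<lambda>x. x i)"
      by (rule continuous_on_subset[OF continuous_on_product_coordinates]) simp
  qed (use Bnn \<alpha> in \<open>auto intro!: continuous_intros\<close>)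
  have "compact S"
  proof -
    obtain T where T: "closed T" "T \<inter> B = B \<inter> (\<lambda>x. \<Sum>i\<in>?V. x i powr \<alpha>) -` {1}"
      using cont_norm continuous_on_closed_invariant[of B "\<lambda>x. \<Sum>i\<in>?V. x i powr \<alpha>"]
      by (metis closed_singleton inf_commute)
    have "S = B \<inter> T" using T by (auto simp: S_def)
    then show ?thesis using cB T compact_Int_closed by auto
  qed
  moreover have "S \<noteq> {}"
  proof -
    obtain v where v: "v \<in> ?V" using ne by blast
    have "(\<Sum>i\<in>?V. (if i = v then 1 else 0) powr \<alpha>) = (\<Sum>i\<in>?V. if i = v then 1 else (0::real))"
      by (intro sum.cong) auto
    then have "(\<lambda>i. if i = v then 1 else 0) \<in> S"
      using v fV unfolding S_def B_def by (auto simp: PiE_iff)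
    then show ?thesis by blast
  qed
  moreover have "continuous_on S (edge_sum (edges G))"
    unfolding edge_sum_def
    by (intro continuous_on_sum continuous_on_prod continuous_on_subset[OF continuous_on_product_coordinates]) auto
  ultimately obtain x where x: "x \<in> S" and max: "\<And>z. z \<in> S \<Longrightarrow> edge_sum (edges G) z \<le> edge_sum (edges G) x"
    using continuous_attains_sup[of S "edge_sum (edges G)"] by blast
  have xnn: "\<And>i. 0 \<le> x i" and xn: "(\<Sum>i\<in>?V. x i powr \<alpha>) = 1"
    using x Bnn by (auto simp: S_def)
  have up: "edge_sum (edges G) z \<le> edge_sum (edges G) x" if z: "(\<Sum>i\<in>?V. \<bar>z i\<bar> powr \<alpha>) = 1" for z
  proof -
    define w where "w i = (if i \<in> ?V then \<bar>z i\<bar> else 0)" for i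
    have "w \<in> B" unfolding B_def w_def using unit_coord_le_1[OF fV \<alpha> z] by auto
    moreover have "(\<Sum>i\<in>?V. w i powr \<alpha>) = 1"
      using z by (simp add: w_def)
    ultimately have "w \<in> S" by (simp add: S_def)
    from max[OF this] have "edge_sum (edges G) (\<lambda>i. \<bar>z i\<bar>) \<le> edge_sum (edges G) x"
      using edge_sum_cong[OF G, of w "\<lambda>i. \<bar>z i\<bar>"] by (simp add: w_def)
    then show ?thesis using edge_sum_le_abs[of "edges G" z] by simp
  qed
  have "spectral_lambda k \<alpha> G = fact k * edge_sum (edges G) x"
    unfolding spectral_lambda_eq
    by (rule cSup_eq_maximum) (use up xn xnn in \<open>auto intro!: exI[of _ x]\<close>)
  then show ?thesis using that xnn xn by blast
qed

text \<open>The homogeneous form of the definition: both sides have degree \<open>k\<close> in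
  \<open>x\<close>, so a nonzero vector can be normalised. At the zero vector the edge polynomial
  vanishes because \<open>k\<close> is positive.\<close>

lemma edge_sum_le_spectral_lambda:
  assumes G: "kgraph k G" and k: "0 < k" and \<alpha>: "0 < \<alpha>" and x: "\<And>i. i \<in> verts G \<Longrightarrow> 0 \<le> x i"
  shows "fact k * edge_sum (edges G) x
    \<le> spectral_lambda k \<alpha> G * (\<Sum>i\<in>verts G. x i powr \<alpha>) powr (real k / \<alpha>)"
proof -
  have fV: "finite (verts G)" using G by (simp add: kgraph_def)
  define N where "N = (\<Sum>i\<in>verts G. x i powr \<alpha>)"
  have N0: "0 \<le> N" by (simp add: N_def sum_nonneg)
  show ?thesis
  proof (cases "N = 0")
    case True
    then have "x i = 0" if "i \<in> verts G" for i
      using that fV by (simp add: N_def sum_nonneg_eq_0_iff)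
    then have "edge_sum (edges G) x = edge_sum (edges G) (\<lambda>i. 0 * x i)"
      using edge_sum_cong[OF G, of x "\<lambda>i. 0 * x i"] by simp
    also have "\<dots> = 0" using k by (subst edge_sum_scale[OF G]) simp
    finally show ?thesis using True by (simp add: N_def)
  next
    case False
    then have Np: "0 < N" using N0 by simp
    define c where "c = N powr (- (1 / \<alpha>))"
    have c0: "0 < c" using Np by (simp add: c_def)
    have ca: "c powr \<alpha> = 1 / N"
      using \<alpha> Np powr_minus_divide[of N 1] by (simp add: c_def powr_powr)
    have "(\<Sum>i\<in>verts G. \<bar>c * x i\<bar> powr \<alpha>) = (\<Sum>i\<in>verts G. c powr \<alpha> * x i powr \<alpha>)"
      using c0 x by (intro sum.cong refl) (simp add: abs_mult powr_mult)
    also have "\<dots> = 1"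
      unfolding sum_distrib_left[symmetric] ca N_def[symmetric] using Np by simp
    finally have "fact k * edge_sum (edges G) (\<lambda>i. c * x i) \<le> spectral_lambda k \<alpha> G"
      by (rule unit_le_spectral_lambda[OF G \<alpha>])
    then have le: "c ^ k * (fact k * edge_sum (edges G) x) \<le> spectral_lambda k \<alpha> G"
      by (simp add: edge_sum_scale[OF G] algebra_simps)
    have "N powr (real k / \<alpha>) * c ^ k = 1"
      using Np c0 by (simp add: c_def powr_realpow[symmetric] powr_powr powr_add[symmetric])
    then have "fact k * edge_sum (edges G) x
        = N powr (real k / \<alpha>) * (c ^ k * (fact k * edge_sum (edges G) x))"
      by (simp flip: mult.assoc)
    also have "\<dots> \<le> N powr (real k / \<alpha>) * spectral_lambda k \<alpha> G"
      using le by (intro mult_left_mono) auto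
    finally show ?thesis by (simp add: N_def mult.commute)
  qed
qed

lemma spectral_lambda_nonneg:
  assumes G: "kgraph k G" and "verts G \<noteq> {}" "0 < \<alpha>"
  shows "0 \<le> spectral_lambda k \<alpha> G"
  using spectral_lambda_attained[OF assms] edge_sum_nonneg[OF G]
  by (metis mult_nonneg_nonneg fact_ge_zero)

section \<open>Links, the Lagrange condition and the effect of deleting a vertex\<close>

text \<open>For the edges of a \<open>k\<close>-graph this is the partial derivative of the edge
  polynomial in the coordinate \<open>v\<close>.\<close>

definition link_sum :: "nat set set \<Rightarrow> (nat \<Rightarrow> real) \<Rightarrow> nat \<Rightarrow> real" where
  "link_sum E x v = (\<Sum>e\<in>{e\<in>E. v \<in> e}. \<Prod>i\<in>e - {v}. x i)"

text \<open>The edge polynomial is multilinear, hence affine in each single coordinate.\<close>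

lemma edge_sum_split:
  assumes G: "kgraph k G"
  shows "edge_sum (edges G) (x(v := t)) = edge_sum {e\<in>edges G. v \<notin> e} x + t * link_sum (edges G) x v"
proof -
  have fE: "finite (edges G)" using G by (rule kgraph_finite_edges)
  have "edge_sum (edges G) (x(v := t))
      = (\<Sum>e\<in>{e\<in>edges G. v \<notin> e}. \<Prod>i\<in>e. (x(v := t)) i) + (\<Sum>e\<in>{e\<in>edges G. v \<in> e}. \<Prod>i\<in>e. (x(v := t)) i)"
    unfolding edge_sum_def using fE by (subst sum.union_disjoint[symmetric]) (auto intro!: sum.cong)
  also have "(\<Sum>e\<in>{e\<in>edges G. v \<notin> e}. \<Prod>i\<in>e. (x(v := t)) i) = edge_sum {e\<in>edges G. v \<notin> e} x"
    unfolding edge_sum_def by (intro sum.cong prod.cong refl) auto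
  also have "(\<Sum>e\<in>{e\<in>edges G. v \<in> e}. \<Prod>i\<in>e. (x(v := t)) i) = t * link_sum (edges G) x v"
    unfolding link_sum_def sum_distrib_left
  proof (rule sum.cong[OF refl])
    fix e assume e: "e \<in> {e\<in>edges G. v \<in> e}"
    then have "finite e" using G kgraph_finite_edge by blast
    then have "(\<Prod>i\<in>e. (x(v := t)) i) = t * (\<Prod>i\<in>e - {v}. (x(v := t)) i)"
      using e by (subst prod.remove[of _ v]) auto
    also have "(\<Prod>i\<in>e - {v}. (x(v := t)) i) = (\<Prod>i\<in>e - {v}. x i)"
      by (intro prod.cong) auto
    finally show "(\<Prod>i\<in>e. (x(v := t)) i) = t * (\<Prod>i\<in>e - {v}. x i)" .
  qed
  finally show ?thesis .
qed

text \<open>Obtained by varying a single coordinate in the homogeneous form of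
  the maximality of \<open>x\<close>.\<close>

lemma eigen_equation:
  assumes G: "kgraph k G" and k: "0 < k" and \<alpha>: "1 < \<alpha>"
    and x: "\<And>i. 0 \<le> x i" "(\<Sum>i\<in>verts G. x i powr \<alpha>) = 1"
    and lam: "spectral_lambda k \<alpha> G = fact k * edge_sum (edges G) x"
    and v: "v \<in> verts G" "0 < x v"
  shows "fact (k - 1) * link_sum (edges G) x v = spectral_lambda k \<alpha> G * x v powr (\<alpha> - 1)"
proof -
  have fV: "finite (verts G)" using G by (simp add: kgraph_def)
  define l where "l = spectral_lambda k \<alpha> G"
  define A where "A = edge_sum {e\<in>edges G. v \<notin> e} x"
  define S where "S = link_sum (edges G) x v"
  \<comment> \<open>The share of the norm carried by the other coordinates, which stays fixed while
    the coordinate at \<open>v\<close> varies.\<close>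
  define r where "r = 1 - x v powr \<alpha>"
  \<comment> \<open>The slack in the homogeneous inequality: it is nonnegative and vanishes at
    \<open>x v\<close>. Since \<open>x v\<close> is positive, this is an interior minimum, and the
    derivative is 0 there.\<close>
  define g where "g t = l * (r + t powr \<alpha>) powr (real k / \<alpha>) - fact k * (A + t * S)" for t
  have norm: "(\<Sum>i\<in>verts G. (x(v := t)) i powr \<alpha>) = r + t powr \<alpha>" for t
  proof -
    have "(\<Sum>i\<in>verts G. (x(v := t)) i powr \<alpha>) = t powr \<alpha> + (\<Sum>i\<in>verts G - {v}. x i powr \<alpha>)"
      using fV v by (subst sum.remove[of _ v]) (auto intro!: sum.cong)
    moreover have "1 = x v powr \<alpha> + (\<Sum>i\<in>verts G - {v}. x i powr \<alpha>)"
      using fV v x(2) by (metis sum.remove)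
    ultimately show ?thesis by (simp add: r_def)
  qed
  have g0: "0 \<le> g t" if "0 \<le> t" for t
    using edge_sum_le_spectral_lambda[OF G k, of \<alpha> "x(v := t)"] that x \<alpha>
    unfolding norm edge_sum_split[OF G] by (simp add: g_def l_def A_def S_def)
  have gx: "g (x v) = 0"
    using edge_sum_split[OF G, of x v "x v"] lam by (simp add: g_def r_def l_def A_def S_def)
  have xa: "0 < x v powr \<alpha>" using v by simp
  have "(g has_real_derivative
      l * (real k / \<alpha> * (r + x v powr \<alpha>) powr (real k / \<alpha> - 1) * (\<alpha> * x v powr (\<alpha> - 1))) - fact k * S) (at (x v))"
    unfolding g_def using v \<alpha> by (auto intro!: derivative_eq_intros simp: r_def)
  moreover have "0 < x v" by (rule v)
  moreover have "\<forall>y. \<bar>x v - y\<bar> < x v \<longrightarrow> g (x v) \<le> g y"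
    using g0 gx by auto
  ultimately have "l * (real k / \<alpha> * (r + x v powr \<alpha>) powr (real k / \<alpha> - 1) * (\<alpha> * x v powr (\<alpha> - 1))) - fact k * S = 0"
    by (rule DERIV_local_min)
  then have "l * (real k * x v powr (\<alpha> - 1)) = fact k * S"
    using \<alpha> by (simp add: r_def)
  also have "fact k = real k * fact (k - 1)" using k by (simp add: fact_reduce)
  finally have "real k * (l * x v powr (\<alpha> - 1)) = real k * (fact (k - 1) * S)" by (simp add: algebra_simps)
  then show ?thesis using k by (simp add: l_def S_def)
qed

definition delete_vertex :: "hypergraph \<Rightarrow> nat \<Rightarrow> hypergraph" where
  "delete_vertex G v = (verts G - {v}, {e\<in>edges G. v \<notin> e})"

lemma kgraph_delete_vertex: "kgraph k G \<Longrightarrow> kgraph k (delete_vertex G v)"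
  by (auto simp: kgraph_def delete_vertex_def)

lemma free_of_delete_vertex: "free_of \<F> G \<Longrightarrow> free_of \<F> (delete_vertex G v)"
  unfolding free_of_def contains_copy_def delete_vertex_def by fastforce

text \<open>Multiplying the Lagrange condition by \<open>x v\<close> shows that the edges through
  \<open>v\<close> contribute exactly the fraction \<open>real k * x v powr \<alpha>\<close> of the
  total. The rest is bounded by the homogeneous inequality in the smaller graph, where the norm is
  \<open>1 - x v powr \<alpha>\<close>.\<close>

lemma spectral_lambda_delete_vertex:
  assumes G: "kgraph k G" and k: "0 < k" and \<alpha>: "1 < \<alpha>"
    and x: "\<And>i. 0 \<le> x i" "(\<Sum>i\<in>verts G. x i powr \<alpha>) = 1"
    and lam: "spectral_lambda k \<alpha> G = fact k * edge_sum (edges G) x"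
    and v: "v \<in> verts G"
  shows "spectral_lambda k \<alpha> G * (1 - real k * x v powr \<alpha>)
    \<le> spectral_lambda k \<alpha> (delete_vertex G v) * (1 - x v powr \<alpha>) powr (real k / \<alpha>)"
proof -
  have fV: "finite (verts G)" using G by (simp add: kgraph_def)
  have "fact k * (x v * link_sum (edges G) x v) = real k * spectral_lambda k \<alpha> G * x v powr \<alpha>"
  proof (cases "x v = 0")
    case False
    then have xv: "0 < x v" using x(1)[of v] by simp
    have "fact k = real k * (fact (k - 1) :: real)" using k by (simp add: fact_reduce)
    then have "fact k * (x v * link_sum (edges G) x v)
        = real k * x v * (fact (k - 1) * link_sum (edges G) x v)" by simp
    also have "\<dots> = real k * spectral_lambda k \<alpha> G * (x v * x v powr (\<alpha> - 1))"
      using eigen_equation[OF G k \<alpha> x lam v xv] by simp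
    also have "x v * x v powr (\<alpha> - 1) = x v powr \<alpha>"
      using xv by (simp add: powr_diff)
    finally show ?thesis .
  qed simp
  moreover have "edge_sum (edges G) x = edge_sum (edges (delete_vertex G v)) x + x v * link_sum (edges G) x v"
    using edge_sum_split[OF G, of x v "x v"] by (simp add: delete_vertex_def)
  ultimately have "spectral_lambda k \<alpha> G * (1 - real k * x v powr \<alpha>) = fact k * edge_sum (edges (delete_vertex G v)) x"
    using lam by algebra
  also have "\<dots> \<le> spectral_lambda k \<alpha> (delete_vertex G v)
      * (\<Sum>i\<in>verts (delete_vertex G v). x i powr \<alpha>) powr (real k / \<alpha>)"
    using edge_sum_le_spectral_lambda[OF kgraph_delete_vertex[OF G] k, where \<alpha> = \<alpha> and x = x] x \<alpha> by simp
  also have "(\<Sum>i\<in>verts (delete_vertex G v). x i powr \<alpha>) = 1 - x v powr \<alpha>"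
    using x(2) v fV by (simp add: delete_vertex_def sum_diff1)
  finally show ?thesis .
qed

section \<open>Balancing the parts\<close>

definition balanced_on :: "'a set \<Rightarrow> 'i set \<Rightarrow> ('a \<Rightarrow> 'i) \<Rightarrow> bool" where
  "balanced_on V L \<phi> \<longleftrightarrow> (\<forall>i\<in>L. \<forall>j\<in>L. card {v\<in>V. \<phi> v = i} \<le> card {v\<in>V. \<phi> v = j} + 1)"

lemma sum_over_parts:
  fixes f :: "'a \<Rightarrow> 'b::comm_monoid_add"
  assumes "finite V" "finite L" "\<phi> ` V \<subseteq> L"
  shows "(\<Sum>i\<in>L. \<Sum>v\<in>{v\<in>V. \<phi> v = i}. f v) = (\<Sum>v\<in>V. f v)"
  using assms by (rule sum.group)

text \<open>The two chosen variables enter only through their sum and their product, so a change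
  that keeps the sum is judged by the product alone.\<close>

lemma esym_two_variables:
  assumes L: "finite L" "i \<in> L" "j \<in> L" "i \<noteq> j"
  shows "esym (Suc (Suc c)) L y = esym (Suc (Suc c)) (L - {i, j}) y
    + (y i + y j) * esym (Suc c) (L - {i, j}) y + y i * y j * esym c (L - {i, j}) y"
proof -
  have L1: "L = insert i (insert j (L - {i, j}))" using L by auto
  show ?thesis
    using L by (subst L1) (simp add: esym_insert algebra_simps)
qed

text \<open>Moving one vertex from a part of size \<open>n\<^sub>1\<close> to a part of size \<open>n\<^sub>2 \<le> n\<^sub>1 - 2\<close> replaces the pairs
  (total weight, size) of the two parts by convex combinations with coefficient \<open>\<theta> = 1/(n\<^sub>1 - n\<^sub>2)\<close>:
  the norm does not increase by joint convexity, and the product of the two totals does not decrease.\<close>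

lemma balancing_step:
  fixes V :: "'a set" and x :: "'a \<Rightarrow> real" and \<phi> :: "'a \<Rightarrow> 'i"
  defines "P \<equiv> \<lambda>\<phi> i. {v\<in>V. \<phi> v = i}"
  assumes V: "finite V" and L: "finite L" and \<phi>: "\<phi> ` V \<subseteq> L" and x: "\<forall>v\<in>V. 0 < x v"
    and k: "2 \<le> k" and \<alpha>: "1 < \<alpha>" and ij: "i \<in> L" "j \<in> L" "card (P \<phi> j) + 2 \<le> card (P \<phi> i)"
    and ne: "partite_edges k V \<phi> \<noteq> {}"
  obtains \<phi>' :: "'a \<Rightarrow> 'i" and x' :: "'a \<Rightarrow> real" where "\<phi>' ` V \<subseteq> L" "\<forall>v\<in>V. 0 < x' v"
    "(\<Sum>t\<in>L. (card (P \<phi>' t))\<^sup>2) < (\<Sum>t\<in>L. (card (P \<phi> t))\<^sup>2)"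
    "(\<Sum>v\<in>V. x' v powr \<alpha>) \<le> (\<Sum>v\<in>V. x v powr \<alpha>)"
    "(\<Sum>e\<in>partite_edges k V \<phi>. \<Prod>v\<in>e. x v) \<le> (\<Sum>e\<in>partite_edges k V \<phi>'. \<Prod>v\<in>e. x' v)"
    "(\<Sum>v\<in>V. x' v powr \<alpha>) < (\<Sum>v\<in>V. x v powr \<alpha>) \<or>
     (\<Sum>e\<in>partite_edges k V \<phi>. \<Prod>v\<in>e. x v) < (\<Sum>e\<in>partite_edges k V \<phi>'. \<Prod>v\<in>e. x' v)"
proof -
  define n1 where "n1 = card (P \<phi> i)"
  define n2 where "n2 = card (P \<phi> j)"
  define R where "R = L - {i, j}"
  have n12: "n2 + 2 \<le> n1" using ij by (simp add: n1_def n2_def)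
  have inej: "i \<noteq> j" using ij by auto
  have fP: "finite (P \<psi> t)" for \<psi> t using V by (simp add: P_def)
  have Lij: "L = insert i (insert j R)" "i \<notin> R" "j \<notin> R" "finite R" using L ij by (auto simp: R_def)
  \<comment> \<open>Any vertex of the larger part may move, since the new vector will be constant on
    each part.\<close>
  obtain u where u: "u \<in> P \<phi> i" using n12 n1_def by (metis card.empty ex_in_conv le_zero_eq add_is_0 zero_neq_numeral)
  define \<phi>' where "\<phi>' = \<phi>(u := j)"
  have uV: "u \<in> V" "\<phi> u = i" using u by (auto simp: P_def)
  have P'i: "P \<phi>' i = P \<phi> i - {u}" and P'j: "P \<phi>' j = insert u (P \<phi> j)"
    and P'R: "\<And>t. t \<in> R \<Longrightarrow> P \<phi>' t = P \<phi> t"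
    using uV inej by (auto simp: P_def \<phi>'_def R_def)
  have uj: "u \<notin> P \<phi> j" using uV inej by (auto simp: P_def)
  have c1: "card (P \<phi>' i) = n1 - 1" using u fP by (simp add: P'i n1_def)
  have c2: "card (P \<phi>' j) = n2 + 1" using uj fP by (simp add: P'j n2_def)
  have \<phi>'L: "\<phi>' ` V \<subseteq> L" using \<phi> ij by (auto simp: \<phi>'_def)

  define y where "y t = (\<Sum>v\<in>P \<phi> t. x v)" for t
  \<comment> \<open>With this coefficient the convex combinations of the two sizes are exactly
    \<open>n1 - 1\<close> and \<open>n2 + 1\<close>; see \<open>w1\<close> and
    \<open>w2\<close>.\<close>
  define \<theta> :: real where "\<theta> = 1 / (real n1 - real n2)"
  have d2: "2 \<le> real n1 - real n2" using n12 by linarith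
  have \<theta>: "0 < \<theta>" "\<theta> < 1" "\<theta> * (real n1 - real n2) = 1"
    using d2 by (auto simp: \<theta>_def)
  define y1 where "y1 = (1 - \<theta>) * y i + \<theta> * y j"
  define y2 where "y2 = \<theta> * y i + (1 - \<theta>) * y j"
  define y' where "y' t = (if t = i then y1 else if t = j then y2 else y t)" for t
  define x' where "x' v = y' (\<phi>' v) / real (card (P \<phi>' (\<phi>' v)))" for v
  have y0: "0 \<le> y t" for t unfolding y_def using x by (intro sum_nonneg) (auto simp: P_def intro: less_imp_le)
  have ypos: "0 < y t" if "P \<phi> t \<noteq> {}" for t
    unfolding y_def using x that fP by (intro sum_pos) (auto simp: P_def)
  have yi: "0 < y i" using ypos u by blast
  have y1pos: "0 < y1" unfolding y1_def using yi y0[of j] \<theta> by (intro add_pos_nonneg) auto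
  have y2pos: "0 < y2" unfolding y2_def using yi y0[of j] \<theta> by (intro add_pos_nonneg) auto
  have x'pos: "0 < x' v" if v: "v \<in> V" for v
  proof -
    define t where "t = \<phi>' v"
    have vt: "v \<in> P \<phi>' t" using v by (simp add: P_def t_def)
    then have "0 < card (P \<phi>' t)" using fP card_gt_0_iff by blast
    moreover have "0 < y' t"
    proof -
      have "0 < y t" if "t \<noteq> i" "t \<noteq> j"
      proof -
        have "t \<in> R" using that \<phi>'L v by (auto simp: R_def t_def)
        then show ?thesis using vt P'R ypos by blast
      qed
      then show ?thesis using y1pos y2pos by (simp add: y'_def)
    qed
    ultimately show ?thesis by (simp add: x'_def t_def)
  qed
  have x'P: "x' v = y' t / real (card (P \<phi>' t))" if "v \<in> P \<phi>' t" for v t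
    using that by (auto simp: x'_def P_def)
  have y'sum: "(\<Sum>v\<in>P \<phi>' t. x' v) = y' t" if t: "t \<in> L" for t
  proof (cases "P \<phi>' t = {}")
    case True
    then have "t \<noteq> i" "t \<noteq> j" using c1 c2 n12 by auto
    then have "y' t = y t" "P \<phi> t = {}" using True P'R[of t] t by (auto simp: y'_def R_def)
    then show ?thesis using True by (simp add: y_def)
  next
    case False
    then have "card (P \<phi>' t) \<noteq> 0" using fP by simp
    then show ?thesis using x'P by simp
  qed

  \<comment> \<open>The norm of a part whose total \<open>z t\<close> is spread evenly. By the power
    mean inequality this is the least norm possible for that total, and \<open>x'\<close> attains
    it.\<close>
  define h where "h \<psi> z t = real (card (P \<psi> t)) * (z t / real (card (P \<psi> t))) powr \<alpha>" for \<psi> and z :: "'i \<Rightarrow> real" and t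
  have "(\<Sum>v\<in>V. x' v powr \<alpha>) = (\<Sum>t\<in>L. \<Sum>v\<in>P \<phi>' t. x' v powr \<alpha>)"
    unfolding P_def using V L \<phi>'L by (rule sum_over_parts[symmetric])
  also have "\<dots> = (\<Sum>t\<in>L. h \<phi>' y' t)"
    using x'P by (simp add: h_def)
  also have "\<dots> = h \<phi>' y' i + h \<phi>' y' j + (\<Sum>t\<in>R. h \<phi>' y' t)"
    using Lij inej by (simp add: add.assoc)
  also have "(\<Sum>t\<in>R. h \<phi>' y' t) = (\<Sum>t\<in>R. h \<phi> y t)"
    using P'R Lij by (intro sum.cong refl) (auto simp: h_def y'_def)
  finally have N': "(\<Sum>v\<in>V. x' v powr \<alpha>) = h \<phi>' y' i + h \<phi>' y' j + (\<Sum>t\<in>R. h \<phi> y t)" .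
  have "h \<phi> y i + h \<phi> y j + (\<Sum>t\<in>R. h \<phi> y t) = (\<Sum>t\<in>L. h \<phi> y t)"
    using Lij inej by (simp add: add.assoc)
  also have "\<dots> \<le> (\<Sum>t\<in>L. \<Sum>v\<in>P \<phi> t. x v powr \<alpha>)"
    unfolding h_def y_def using x by (intro sum_mono power_mean \<alpha>) (auto simp: P_def intro: less_imp_le)
  also have "\<dots> = (\<Sum>v\<in>V. x v powr \<alpha>)"
    unfolding P_def using V L \<phi> by (rule sum_over_parts)
  finally have N: "h \<phi> y i + h \<phi> y j + (\<Sum>t\<in>R. h \<phi> y t) \<le> (\<Sum>v\<in>V. x v powr \<alpha>)" .

  define a where "a = y i / real n1"
  define b where "b = y j / real n2"
  have a: "real n1 * a = y i" using n12 by (simp add: a_def)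
  have b: "real n2 * b = y j"
    using fP by (cases "n2 = 0") (auto simp: b_def n2_def y_def)
  have ab0: "0 \<le> a" "0 \<le> b" using y0 by (simp_all add: a_def b_def)
  have w1: "(1 - \<theta>) * real n1 + \<theta> * real n2 = real (n1 - 1)" and w2: "\<theta> * real n1 + (1 - \<theta>) * real n2 = real (n2 + 1)"
    using \<theta>(3) n12 by (simp_all add: algebra_simps of_nat_diff)
  have e1: "((1 - \<theta>) * real n1) * a + (\<theta> * real n2) * b = y1" and e2: "(\<theta> * real n1) * a + ((1 - \<theta>) * real n2) * b = y2"
    unfolding y1_def y2_def a[symmetric] b[symmetric] by (simp_all add: algebra_simps)
  have hi: "h \<phi> y i = real n1 * a powr \<alpha>" and hj: "h \<phi> y j = real n2 * b powr \<alpha>"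
    by (simp_all add: h_def a_def b_def n1_def n2_def)
  have h'i: "h \<phi>' y' i = real (n1 - 1) * (y1 / real (n1 - 1)) powr \<alpha>"
    and h'j: "h \<phi>' y' j = real (n2 + 1) * (y2 / real (n2 + 1)) powr \<alpha>"
    using c1 c2 inej by (simp_all add: h_def y'_def)
  have pos1: "0 < (1 - \<theta>) * real n1 + \<theta> * real n2" unfolding w1 using n12 by simp
  have pos2: "0 < \<theta> * real n1 + (1 - \<theta>) * real n2" unfolding w2 by simp
  have u0: "0 \<le> (1 - \<theta>) * real n1" "0 \<le> \<theta> * real n2" "0 \<le> \<theta> * real n1" "0 \<le> (1 - \<theta>) * real n2"
    using \<theta> by auto
  have le1: "h \<phi>' y' i \<le> (1 - \<theta>) * real n1 * a powr \<alpha> + \<theta> * real n2 * b powr \<alpha>"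
    using powr_weighted_mean(1)[OF \<alpha> ab0 u0(1,2) pos1] unfolding w1 e1 h'i .
  have le2: "h \<phi>' y' j \<le> \<theta> * real n1 * a powr \<alpha> + (1 - \<theta>) * real n2 * b powr \<alpha>"
    using powr_weighted_mean(1)[OF \<alpha> ab0 u0(3,4) pos2] unfolding w2 e2 h'j .
  have hsum: "h \<phi> y i + h \<phi> y j = ((1 - \<theta>) * real n1 * a powr \<alpha> + \<theta> * real n2 * b powr \<alpha>)
      + (\<theta> * real n1 * a powr \<alpha> + (1 - \<theta>) * real n2 * b powr \<alpha>)"
    unfolding hi hj by (simp add: algebra_simps)
  have Nle: "(\<Sum>v\<in>V. x' v powr \<alpha>) \<le> (\<Sum>v\<in>V. x v powr \<alpha>)"
    using N N' le1 le2 hsum by linarith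

  obtain c where kc: "k = Suc (Suc c)" using k by (metis add_2_eq_Suc le_Suc_ex)
  have val: "(\<Sum>e\<in>partite_edges k V \<phi>. \<Prod>v\<in>e. x v) = esym k L y"
    using sum_partite_edges[OF V L \<phi>, of x k] by (auto simp: y_def P_def intro: esym_cong)
  have val': "(\<Sum>e\<in>partite_edges k V \<phi>'. \<Prod>v\<in>e. x' v) = esym k L y'"
    using sum_partite_edges[OF V L \<phi>'L, of x' k] y'sum by (auto simp: P_def intro: esym_cong)
  have yR: "esym m R y' = esym m R y" for m
    using Lij by (intro esym_cong) (auto simp: y'_def)
  have diff: "esym k L y' - esym k L y = \<theta> * (1 - \<theta>) * (y i - y j)\<^sup>2 * esym c R y"
  proof -
    have "esym k L y' - esym k L y = (y1 + y2 - (y i + y j)) * esym (Suc c) R y + (y1 * y2 - y i * y j) * esym c R y"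
      unfolding kc esym_two_variables[OF L ij(1,2) inej] R_def[symmetric] yR
      using inej by (simp add: y'_def algebra_simps)
    also have "y1 + y2 - (y i + y j) = 0" by (simp add: y1_def y2_def algebra_simps)
    also have "y1 * y2 - y i * y j = \<theta> * (1 - \<theta>) * (y i - y j)\<^sup>2"
      by (simp add: y1_def y2_def algebra_simps power2_eq_square)
    finally show ?thesis by simp
  qed
  obtain e where e: "e \<in> partite_edges k V \<phi>" using ne by blast
  \<comment> \<open>An existing edge uses at least \<open>c\<close> colors other than
    \<open>i\<close> and \<open>j\<close>, and the corresponding part totals are positive.\<close>
  have Cpos: "0 < esym c R y"
  proof (rule esym_pos)
    from e have eV: "e \<subseteq> V" and ce: "card (\<phi> ` e) = k" by (auto simp: partite_edges_def card_image)
    have "\<phi> ` e \<subseteq> L" using eV \<phi> by blast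
    have "finite (\<phi> ` e)" using finite_subset[OF eV V] by simp
    then have "k - card {i, j} \<le> card (\<phi> ` e - {i, j})"
      using diff_card_le_card_Diff[of "{i, j}" "\<phi> ` e"] ce by simp
    then show "c \<le> card (\<phi> ` e - {i, j})" using inej kc by simp
    show "\<phi> ` e - {i, j} \<subseteq> R" using \<open>\<phi> ` e \<subseteq> L\<close> by (auto simp: R_def)
    show "0 < y t" if "t \<in> \<phi> ` e - {i, j}" for t
      using that e by (intro ypos) (auto simp: P_def partite_edges_def)
  qed (use Lij y0 in auto)
  have val_le: "esym k L y \<le> esym k L y'"
    using diff Cpos \<theta> by (smt (verit) mult_nonneg_nonneg zero_le_power2)
  \<comment> \<open>Equal totals in parts of different sizes have different averages, so the norm
    drops strictly; unequal totals make the product of the two totals grow strictly.\<close>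
  have strict: "(\<Sum>v\<in>V. x' v powr \<alpha>) < (\<Sum>v\<in>V. x v powr \<alpha>) \<or> esym k L y < esym k L y'"
  proof (cases "y i = y j")
    case True
    then have "0 < n2" using yi b by (cases "n2 = 0") auto
    have "a \<noteq> b"
    proof
      assume "a = b"
      then have "real n1 * a = real n2 * a" using a b True by simp
      then show False using n12 yi a by auto
    qed
    have "0 < (1 - \<theta>) * real n1" "0 < \<theta> * real n2" using \<theta> \<open>0 < n2\<close> n12 by auto
    from powr_weighted_mean(2)[OF \<alpha> ab0 u0(1,2) pos1 this \<open>a \<noteq> b\<close>]
    have "h \<phi>' y' i < (1 - \<theta>) * real n1 * a powr \<alpha> + \<theta> * real n2 * b powr \<alpha>"
      unfolding w1 e1 h'i .
    then show ?thesis using N N' le2 hsum by linarith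
  next
    case False
    then have "0 < \<theta> * (1 - \<theta>) * (y i - y j)\<^sup>2 * esym c R y"
      using \<theta> Cpos by (intro mult_pos_pos) auto
    then show ?thesis using diff by linarith
  qed
  have meas: "(\<Sum>t\<in>L. (card (P \<phi>' t))\<^sup>2) < (\<Sum>t\<in>L. (card (P \<phi> t))\<^sup>2)"
  proof -
    have "(\<Sum>t\<in>L. (card (P \<phi>' t))\<^sup>2) = (n1 - 1)\<^sup>2 + (n2 + 1)\<^sup>2 + (\<Sum>t\<in>R. (card (P \<phi> t))\<^sup>2)"
      using Lij inej c1 c2 P'R by (simp add: add.assoc)
    moreover have "(\<Sum>t\<in>L. (card (P \<phi> t))\<^sup>2) = n1\<^sup>2 + n2\<^sup>2 + (\<Sum>t\<in>R. (card (P \<phi> t))\<^sup>2)"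
      using Lij inej by (simp add: add.assoc n1_def n2_def)
    moreover have "(n1 - 1)\<^sup>2 + (n2 + 1)\<^sup>2 < n1\<^sup>2 + n2\<^sup>2"
    proof -
      obtain d where "n1 = n2 + 2 + d" using n12 le_Suc_ex by blast
      then show ?thesis by (simp add: power2_eq_square algebra_simps)
    qed
    ultimately show ?thesis by linarith
  qed
  have "\<forall>v\<in>V. 0 < x' v" using x'pos by blast
  from that[OF \<phi>'L this meas Nle] show ?thesis
    using val_le strict unfolding val val' by blast
qed

text \<open>Repeat \<open>balancing_step\<close> until the coloring is balanced; the sum of squared
  part sizes decreases each time. A single step already makes the inequality strict, and the
  homogeneous form lets the norm change along the way.\<close>

lemma partite_sum_le_balanced:
  fixes x :: "'a \<Rightarrow> real" and \<phi> :: "'a \<Rightarrow> 'i"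
  assumes V: "finite V" and L: "finite L" and k: "2 \<le> k" and \<alpha>: "1 < \<alpha>" and \<rho>: "0 < \<rho>"
    and bal: "\<And>(\<phi> :: 'a \<Rightarrow> 'i) (x :: 'a \<Rightarrow> real). \<phi> ` V \<subseteq> L \<Longrightarrow> balanced_on V L \<phi> \<Longrightarrow> \<forall>v\<in>V. 0 < x v \<Longrightarrow>
        (\<Sum>e\<in>partite_edges k V \<phi>. \<Prod>v\<in>e. x v) \<le> \<rho> * (\<Sum>v\<in>V. x v powr \<alpha>) powr (real k / \<alpha>)"
    and \<phi>: "\<phi> ` V \<subseteq> L" and x: "\<forall>v\<in>V. 0 < x v" and ne: "partite_edges k V \<phi> \<noteq> {}"
  shows "(\<Sum>e\<in>partite_edges k V \<phi>. \<Prod>v\<in>e. x v) \<le> \<rho> * (\<Sum>v\<in>V. x v powr \<alpha>) powr (real k / \<alpha>) \<and>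
    (\<not> balanced_on V L \<phi> \<longrightarrow>
      (\<Sum>e\<in>partite_edges k V \<phi>. \<Prod>v\<in>e. x v) < \<rho> * (\<Sum>v\<in>V. x v powr \<alpha>) powr (real k / \<alpha>))"
  using \<phi> x ne
proof (induction "\<Sum>t\<in>L. (card {v\<in>V. \<phi> v = t})\<^sup>2" arbitrary: \<phi> x rule: less_induct)
  case less
  show ?case
  proof (cases "balanced_on V L \<phi>")
    case True
    then show ?thesis using bal[OF less.prems(1) True less.prems(2)] by simp
  next
    case False
    then obtain i j where ij: "i \<in> L" "j \<in> L" "card {v\<in>V. \<phi> v = j} + 2 \<le> card {v\<in>V. \<phi> v = i}"
      unfolding balanced_on_def by (auto simp: not_le less_eq_Suc_le)
    obtain \<phi>' :: "'a \<Rightarrow> 'i" and x' :: "'a \<Rightarrow> real" where s: "\<phi>' ` V \<subseteq> L" "\<forall>v\<in>V. 0 < x' v"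
      "(\<Sum>t\<in>L. (card {v\<in>V. \<phi>' v = t})\<^sup>2) < (\<Sum>t\<in>L. (card {v\<in>V. \<phi> v = t})\<^sup>2)"
      "(\<Sum>v\<in>V. x' v powr \<alpha>) \<le> (\<Sum>v\<in>V. x v powr \<alpha>)"
      "(\<Sum>e\<in>partite_edges k V \<phi>. \<Prod>v\<in>e. x v) \<le> (\<Sum>e\<in>partite_edges k V \<phi>'. \<Prod>v\<in>e. x' v)"
      "(\<Sum>v\<in>V. x' v powr \<alpha>) < (\<Sum>v\<in>V. x v powr \<alpha>) \<or>
       (\<Sum>e\<in>partite_edges k V \<phi>. \<Prod>v\<in>e. x v) < (\<Sum>e\<in>partite_edges k V \<phi>'. \<Prod>v\<in>e. x' v)"
      by (rule balancing_step[OF V L less.prems(1,2) k \<alpha> ij less.prems(3)]) (rule that)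
    have pos: "0 < (\<Sum>e\<in>partite_edges k V \<phi>. \<Prod>v\<in>e. x v)"
      using less.prems(2,3) finite_partite_edges[OF V]
      by (intro sum_pos prod_pos) (auto simp: partite_edges_def)
    \<comment> \<open>The edge polynomial stays positive, so the new coloring still admits an edge
      and the induction can continue.\<close>
    have ne': "partite_edges k V \<phi>' \<noteq> {}"
      using pos s(5) by auto
    have IH: "(\<Sum>e\<in>partite_edges k V \<phi>'. \<Prod>v\<in>e. x' v) \<le> \<rho> * (\<Sum>v\<in>V. x' v powr \<alpha>) powr (real k / \<alpha>)"
      using less.hyps[OF s(3,1,2) ne'] by blast
    have N'0: "0 \<le> (\<Sum>v\<in>V. x' v powr \<alpha>)" by (simp add: sum_nonneg)
    have ka: "0 < real k / \<alpha>" using k \<alpha> by simp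
    have mono: "(\<Sum>v\<in>V. x' v powr \<alpha>) powr (real k / \<alpha>) \<le> (\<Sum>v\<in>V. x v powr \<alpha>) powr (real k / \<alpha>)"
      using s(4) N'0 ka by (intro powr_mono2) auto
    have "(\<Sum>e\<in>partite_edges k V \<phi>. \<Prod>v\<in>e. x v) < \<rho> * (\<Sum>v\<in>V. x v powr \<alpha>) powr (real k / \<alpha>)"
      using s(6)
    proof
      assume "(\<Sum>v\<in>V. x' v powr \<alpha>) < (\<Sum>v\<in>V. x v powr \<alpha>)"
      then have "(\<Sum>v\<in>V. x' v powr \<alpha>) powr (real k / \<alpha>) < (\<Sum>v\<in>V. x v powr \<alpha>) powr (real k / \<alpha>)"
        using N'0 ka by (intro powr_less_mono2) auto
      then have "\<rho> * (\<Sum>v\<in>V. x' v powr \<alpha>) powr (real k / \<alpha>) < \<rho> * (\<Sum>v\<in>V. x v powr \<alpha>) powr (real k / \<alpha>)"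
        using \<rho> by simp
      then show ?thesis using s(5) IH by linarith
    next
      assume "(\<Sum>e\<in>partite_edges k V \<phi>. \<Prod>v\<in>e. x v) < (\<Sum>e\<in>partite_edges k V \<phi>'. \<Prod>v\<in>e. x' v)"
      also have "\<dots> \<le> \<rho> * (\<Sum>v\<in>V. x v powr \<alpha>) powr (real k / \<alpha>)"
        using IH mono \<rho> by (meson less_imp_le mult_left_mono order_trans)
      finally show ?thesis .
    qed
    then show ?thesis by simp
  qed
qed

section \<open>Uniqueness of balanced complete partite graphs up to isomorphism\<close>

text \<open>All sizes equal the minimum \<open>m\<close> or \<open>m + 1\<close>, so counting the
  vertices is division with remainder by the number of parts.\<close>

lemma balanced_on_part_sizes:
  assumes V: "finite V" and L: "finite L" "L \<noteq> {}" and \<phi>: "\<phi> ` V \<subseteq> L" and bal: "balanced_on V L \<phi>"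
  shows "\<And>i. i \<in> L \<Longrightarrow> card {v\<in>V. \<phi> v = i} = card V div card L \<or> card {v\<in>V. \<phi> v = i} = Suc (card V div card L)"
    and "card {i\<in>L. card {v\<in>V. \<phi> v = i} = Suc (card V div card L)} = card V mod card L"
proof -
  let ?n = "\<lambda>i. card {v\<in>V. \<phi> v = i}"
  define m where "m = Min (?n ` L)"
  have "m \<in> ?n ` L" unfolding m_def using L by (intro Min_in) auto
  then obtain i0 where i0: "i0 \<in> L" "?n i0 = m" by blast
  have ge: "m \<le> ?n i" if "i \<in> L" for i unfolding m_def using L that by auto
  have le: "?n i \<le> m + 1" if "i \<in> L" for i
    using bal that i0 unfolding balanced_on_def by metis
  have vals: "?n i = m \<or> ?n i = Suc m" if "i \<in> L" for i
    using ge[OF that] le[OF that] by linarith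
  let ?A = "{i\<in>L. ?n i = Suc m}"
  have "card V = (\<Sum>i\<in>L. ?n i)"
    using sum_over_parts[OF V L(1) \<phi>, of "\<lambda>_. 1::nat"] by simp
  also have "\<dots> = (\<Sum>i\<in>L. m + (if i \<in> ?A then 1 else 0))"
    using vals by (intro sum.cong) auto
  also have "\<dots> = card L * m + card ?A"
    using L sum.inter_filter[of L "\<lambda>_. 1::nat" "\<lambda>i. ?n i = Suc m"] by (simp add: sum.distrib)
  finally have cV: "card V = card L * m + card ?A" .
  \<comment> \<open>A part of minimal size is not large, so the number of large parts is smaller
    than \<open>card L\<close> and is a genuine remainder.\<close>
  have "i0 \<notin> ?A" using i0 by simp
  then have "?A \<subset> L" using i0(1) by blast
  then have lt: "card ?A < card L" using L psubset_card_mono by blast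
  have "card V div card L = m" using cV lt by simp
  moreover have "card V mod card L = card ?A" using cV lt by simp
  ultimately show "\<And>i. i \<in> L \<Longrightarrow> ?n i = card V div card L \<or> ?n i = Suc (card V div card L)"
    and "card {i\<in>L. ?n i = Suc (card V div card L)} = card V mod card L"
    using vals by auto
qed

text \<open>Both colorings have equally many large parts. A permutation \<open>\<sigma>\<close> of
  the colors sends large parts to large ones and small parts to small ones; bijections between
  matched parts are then glued.\<close>

lemma balanced_colorings_equivalent:
  fixes \<phi> :: "'a \<Rightarrow> 'i" and \<psi> :: "'b \<Rightarrow> 'i"
  assumes V: "finite V" and W: "finite W" and cVW: "card V = card W" and L: "finite L" "L \<noteq> {}"
    and \<phi>: "\<phi> ` V \<subseteq> L" "balanced_on V L \<phi>" and \<psi>: "\<psi> ` W \<subseteq> L" "balanced_on W L \<psi>"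
  obtains f where "bij_betw f V W" "\<And>u v. u \<in> V \<Longrightarrow> v \<in> V \<Longrightarrow> \<phi> u = \<phi> v \<longleftrightarrow> \<psi> (f u) = \<psi> (f v)"
proof -
  define q where "q = card V div card L"
  let ?n = "\<lambda>i. card {v\<in>V. \<phi> v = i}" and ?m = "\<lambda>i. card {w\<in>W. \<psi> w = i}"
  let ?A = "{i\<in>L. ?n i = Suc q}" and ?B = "{i\<in>L. ?m i = Suc q}"
  note pV = balanced_on_part_sizes[OF V L \<phi>, folded q_def]
  note pW = balanced_on_part_sizes[OF W L \<psi>, folded cVW, folded q_def]
  have cAB: "card ?A = card ?B" using pV(2) pW(2) by simp
  have fAB: "finite ?A" "finite ?B" using L by auto
  obtain s where s: "bij_betw s ?A ?B" using finite_same_card_bij[OF fAB cAB] by blast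
  have "card (L - ?A) = card (L - ?B)" 
    using cAB card_Diff_subset[OF fAB(1), of L] card_Diff_subset[OF fAB(2), of L] by (simp only: Collect_subset)
  then obtain s' where s': "bij_betw s' (L - ?A) (L - ?B)"
    using finite_same_card_bij[of "L - ?A" "L - ?B"] L by blast
  define \<sigma> where "\<sigma> i = (if i \<in> ?A then s i else s' i)" for i
  have "bij_betw \<sigma> ?A ?B" using s by (rule bij_betw_cong[THEN iffD2, rotated]) (auto simp: \<sigma>_def)
  moreover have "bij_betw \<sigma> (L - ?A) (L - ?B)"
    using s' by (rule bij_betw_cong[THEN iffD2, rotated]) (auto simp: \<sigma>_def)
  ultimately have \<sigma>AB: "\<sigma> ` ?A = ?B" "\<sigma> ` (L - ?A) = L - ?B"
    and "bij_betw \<sigma> (?A \<union> (L - ?A)) (?B \<union> (L - ?B))"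
    by (simp_all only: bij_betw_imp_surj_on) (rule bij_betw_combine, assumption+, blast)
  moreover have "?A \<union> (L - ?A) = L" "?B \<union> (L - ?B) = L" by auto
  ultimately have \<sigma>: "bij_betw \<sigma> L L" by simp
  have same: "?n i = ?m (\<sigma> i)" if i: "i \<in> L" for i
  proof (cases "i \<in> ?A")
    case True
    then have "\<sigma> i \<in> ?B" using \<sigma>AB by blast
    then show ?thesis using True by simp
  next
    case False
    then have "\<sigma> i \<in> L - ?B" using \<sigma>AB i by blast
    then show ?thesis using False i pV(1)[of i] pW(1)[of "\<sigma> i"] by auto
  qed
  have "\<exists>g. bij_betw g {v\<in>V. \<phi> v = i} {w\<in>W. \<psi> w = \<sigma> i}" if "i \<in> L" for i
    using V W same[OF that] by (intro finite_same_card_bij) auto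
  then obtain g where g: "\<And>i. i \<in> L \<Longrightarrow> bij_betw (g i) {v\<in>V. \<phi> v = i} {w\<in>W. \<psi> w = \<sigma> i}"
    by metis
  define f where "f v = g (\<phi> v) v" for v
  have fW: "f v \<in> W \<and> \<psi> (f v) = \<sigma> (\<phi> v)" if "v \<in> V" for v
    using bij_betwE[OF g[of "\<phi> v"]] \<phi> that by (auto simp: f_def)
  have iff: "\<phi> u = \<phi> v \<longleftrightarrow> \<psi> (f u) = \<psi> (f v)" if "u \<in> V" "v \<in> V" for u v
    using fW[OF that(1)] fW[OF that(2)] that \<phi>(1) inj_on_eq_iff[OF bij_betw_imp_inj_on[OF \<sigma>], of "\<phi> u" "\<phi> v"]
    by auto
  have inj: "inj_on f V"
  proof (rule inj_onI)
    fix u v assume uv: "u \<in> V" "v \<in> V" "f u = f v"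
    then have "\<phi> u = \<phi> v" using iff by auto
    then show "u = v" using uv bij_betw_imp_inj_on[OF g[of "\<phi> v"]] \<phi>(1) by (auto simp: f_def inj_on_def)
  qed
  have "f ` V \<subseteq> W" using fW by auto
  then have "f ` V = W" using W cVW inj by (metis card_image card_subset_eq)
  then show ?thesis using that[of f] inj iff by (auto simp: bij_betw_def)
qed

text \<open>The edge set depends only on which pairs of vertices share a color, and the bijection
  between balanced colorings preserves exactly that.\<close>

lemma isomorphic_partite:
  fixes \<phi> :: "nat \<Rightarrow> 'i" and \<psi> :: "nat \<Rightarrow> 'i"
  assumes "finite V" "finite W" "card V = card W" "finite L" "L \<noteq> {}"
    and "\<phi> ` V \<subseteq> L" "balanced_on V L \<phi>" and "\<psi> ` W \<subseteq> L" "balanced_on W L \<psi>"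
  shows "isomorphic (V, partite_edges k V \<phi>) (W, partite_edges k W \<psi>)"
proof -
  obtain f where f: "bij_betw f V W" and eq: "\<And>u v. u \<in> V \<Longrightarrow> v \<in> V \<Longrightarrow> \<phi> u = \<phi> v \<longleftrightarrow> \<psi> (f u) = \<psi> (f v)"
    using balanced_colorings_equivalent[OF assms] by blast
  have injV: "inj_on f V" and fV: "f ` V = W" using f by (auto simp: bij_betw_def)
  have edge_iff: "f ` e \<in> partite_edges k W \<psi> \<longleftrightarrow> e \<in> partite_edges k V \<phi>" if e: "e \<subseteq> V" for e
  proof -
    have inje: "inj_on f e" using injV e inj_on_subset by blast
    have "inj_on \<psi> (f ` e) \<longleftrightarrow> inj_on \<phi> e"
      using eq e inje by (auto simp: inj_on_def) (metis subsetD)+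
    then show ?thesis
      using e fV inje by (auto simp: partite_edges_def card_image)
  qed
  have "(\<lambda>e. f ` e) ` partite_edges k V \<phi> = partite_edges k W \<psi>"
  proof (intro equalityI subsetI)
    fix e' assume "e' \<in> (\<lambda>e. f ` e) ` partite_edges k V \<phi>"
    then show "e' \<in> partite_edges k W \<psi>" using edge_iff by (auto simp: partite_edges_def)
  next
    fix e' assume e': "e' \<in> partite_edges k W \<psi>"
    then have "e' \<subseteq> f ` V" using fV by (auto simp: partite_edges_def)
    then obtain e where "e \<subseteq> V" "e' = f ` e" by (auto simp: subset_image_iff)
    then show "e' \<in> (\<lambda>e. f ` e) ` partite_edges k V \<phi>" using edge_iff e' by blast
  qed
  then show ?thesis unfolding isomorphic_def using f by auto
qed

lemma spectral_lambda_isomorphic: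
  assumes G: "kgraph k G" and iso: "isomorphic G H"
  shows "spectral_lambda k \<alpha> G = spectral_lambda k \<alpha> H"
proof -
  obtain f where f: "bij_betw f (verts G) (verts H)" and E: "(\<lambda>e. f ` e) ` edges G = edges H"
    using iso by (auto simp: isomorphic_def)
  have inj: "inj_on f (verts G)" and im: "f ` verts G = verts H" using f by (auto simp: bij_betw_def)
  have sub: "e \<subseteq> verts G" if "e \<in> edges G" for e using G that by (auto simp: kgraph_def)
  have injE: "inj_on (\<lambda>e. f ` e) (edges G)"
    using inj sub by (auto simp: inj_on_def inj_on_image_eq_iff[OF inj])
  have es: "edge_sum (edges H) x = edge_sum (edges G) (x \<circ> f)" for x
    unfolding edge_sum_def E[symmetric] using injE inj sub
    by (auto simp: sum.reindex prod.reindex inj_on_subset intro!: sum.cong)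
  have ns: "(\<Sum>i\<in>verts H. \<bar>x i\<bar> powr \<alpha>) = (\<Sum>i\<in>verts G. \<bar>(x \<circ> f) i\<bar> powr \<alpha>)" for x
    unfolding im[symmetric] using inj by (simp add: sum.reindex)
  \<comment> \<open>Injectivity of \<open>f\<close> on the vertices makes every vector on
    \<open>G\<close> a pullback, so both suprema range over the same values.\<close>
  have ext: "\<exists>x. \<forall>i\<in>verts G. z i = (x \<circ> f) i" for z :: "nat \<Rightarrow> real"
    using inj by (intro exI[of _ "z \<circ> inv_into (verts G) f"]) auto
  have "{fact k * edge_sum (edges G) x | x. (\<Sum>i\<in>verts G. \<bar>x i\<bar> powr \<alpha>) = 1}
      = {fact k * edge_sum (edges H) x | x. (\<Sum>i\<in>verts H. \<bar>x i\<bar> powr \<alpha>) = 1}" (is "?A = ?B")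
  proof (intro equalityI subsetI)
    fix c assume "c \<in> ?A"
    then obtain z where z: "c = fact k * edge_sum (edges G) z" "(\<Sum>i\<in>verts G. \<bar>z i\<bar> powr \<alpha>) = 1" by blast
    obtain x where x: "\<forall>i\<in>verts G. z i = (x \<circ> f) i" using ext by blast
    have "(\<Sum>i\<in>verts H. \<bar>x i\<bar> powr \<alpha>) = 1" unfolding ns using z(2) x by simp
    moreover have "c = fact k * edge_sum (edges H) x" unfolding es
      using z(1) edge_sum_cong[OF G, of z "x \<circ> f"] x by simp
    ultimately show "c \<in> ?B" by blast
  next
    fix c assume "c \<in> ?B"
    then show "c \<in> ?A" unfolding es ns by blast
  qed
  then show ?thesis by (simp add: spectral_lambda_eq)
qed

text \<open>The color multiset of an edge is a set of \<open>k\<close> colors exactly when the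
  coloring is injective on the edge. This replaces multiset patterns by
  \<open>partite_edges\<close>.\<close>

lemma colorable_complete_pattern:
  assumes G: "kgraph k G"
  shows "colorable (complete_pattern k l) G
    \<longleftrightarrow> (\<exists>\<phi>. \<phi> ` verts G \<subseteq> {1..l} \<and> edges G \<subseteq> partite_edges k (verts G) \<phi>)"
proof -
  have "image_mset \<phi> (mset_set e) \<in> snd (complete_pattern k l) \<longleftrightarrow> e \<in> partite_edges k (verts G) \<phi>"
    if e: "e \<in> edges G" and \<phi>: "\<phi> ` verts G \<subseteq> {1..l}" for e \<phi>
  proof -
    have fe: "finite e" and ce: "card e = k" and eV: "e \<subseteq> verts G"
      using G e kgraph_finite_edge[OF G e] by (auto simp: kgraph_def)
    show ?thesis
    proof
      assume "image_mset \<phi> (mset_set e) \<in> snd (complete_pattern k l)"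
      then obtain K where K: "image_mset \<phi> (mset_set e) = mset_set K" "K \<subseteq> {1..l}" "card K = k"
        by (auto simp: complete_pattern_def)
      have "finite K" using K(2) finite_subset by blast
      then have "\<phi> ` e = K" using K(1) fe by (metis finite_set_mset_mset_set set_image_mset)
      then have "inj_on \<phi> e" using fe ce K(3) by (intro eq_card_imp_inj_on) auto
      then show "e \<in> partite_edges k (verts G) \<phi>" using ce eV by (simp add: partite_edges_def)
    next
      assume "e \<in> partite_edges k (verts G) \<phi>"
      then have inj: "inj_on \<phi> e" by (simp add: partite_edges_def)
      then have "image_mset \<phi> (mset_set e) = mset_set (\<phi> ` e)" by (rule image_mset_mset_set)
      moreover have "\<phi> ` e \<subseteq> {1..l}" "card (\<phi> ` e) = k" using \<phi> eV ce inj by (auto simp: card_image)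
      ultimately show "image_mset \<phi> (mset_set e) \<in> snd (complete_pattern k l)"
        by (auto simp: complete_pattern_def)
    qed
  qed
  note iff = this
  show ?thesis
  proof
    assume "colorable (complete_pattern k l) G"
    then obtain \<phi> where \<phi>: "\<phi> ` verts G \<subseteq> {1..l}"
      and "\<forall>e\<in>edges G. image_mset \<phi> (mset_set e) \<in> snd (complete_pattern k l)"
      unfolding colorable_def by (auto simp: complete_pattern_def)
    then have "edges G \<subseteq> partite_edges k (verts G) \<phi>" using iff[OF _ \<phi>] by blast
    then show "\<exists>\<phi>. \<phi> ` verts G \<subseteq> {1..l} \<and> edges G \<subseteq> partite_edges k (verts G) \<phi>" using \<phi> by blast
  next
    assume "\<exists>\<phi>. \<phi> ` verts G \<subseteq> {1..l} \<and> edges G \<subseteq> partite_edges k (verts G) \<phi>"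
    then obtain \<phi> where \<phi>: "\<phi> ` verts G \<subseteq> {1..l}" and "edges G \<subseteq> partite_edges k (verts G) \<phi>" by blast
    then have "\<forall>e\<in>edges G. image_mset \<phi> (mset_set e) \<in> snd (complete_pattern k l)"
      using iff[OF _ \<phi>] by blast
    moreover have "fst (complete_pattern k l) = l" by (simp add: complete_pattern_def)
    ultimately show "colorable (complete_pattern k l) G"
      unfolding colorable_def using \<phi> by (intro exI[of _ \<phi>]) simp
  qed
qed

section \<open>Turan graphs and the Turan density\<close>

text \<open>The value of the edge polynomial of the complete \<open>k\<close>-graph on
  \<open>l\<close> vertices at the uniform probability vector. Multiplied by \<open>fact k\<close>
  it becomes the Turan density.\<close>

definition partite_density :: "nat \<Rightarrow> nat \<Rightarrow> real" where
  "partite_density k l = real (l choose k) / real l ^ k"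

lemma partite_density_pos: "k \<le> l \<Longrightarrow> 0 < partite_density k l"
  by (cases "l = 0") (auto simp: partite_density_def)

text \<open>Adding the missing partite edges only increases the sum; Maclaurin's inequality is then
  applied to the part totals.\<close>

lemma edge_sum_partite_le:
  assumes V: "finite V" and \<phi>: "\<phi> ` V \<subseteq> {1..l}" and E: "E \<subseteq> partite_edges k V \<phi>"
    and x: "\<And>v. v \<in> V \<Longrightarrow> 0 \<le> x v"
  shows "edge_sum E x \<le> partite_density k l * (\<Sum>v\<in>V. x v) ^ k"
proof -
  have nn: "0 \<le> (\<Sum>v\<in>{v\<in>V. \<phi> v = i}. x v)" for i using x by (intro sum_nonneg) auto
  have "edge_sum E x \<le> (\<Sum>e\<in>partite_edges k V \<phi>. \<Prod>v\<in>e. x v)"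
    unfolding edge_sum_def using finite_partite_edges[OF V] E x
    by (intro sum_mono2 prod_nonneg) (auto simp: partite_edges_def)
  also have "\<dots> = esym k {1..l} (\<lambda>i. \<Sum>v\<in>{v\<in>V. \<phi> v = i}. x v)"
    using V \<phi> by (intro sum_partite_edges) auto
  also have "\<dots> \<le> real (l choose k) * ((\<Sum>i\<in>{1..l}. \<Sum>v\<in>{v\<in>V. \<phi> v = i}. x v) / real l) ^ k"
    using maclaurin_esym[of "{1..l}" "\<lambda>i. \<Sum>v\<in>{v\<in>V. \<phi> v = i}. x v" k] nn by simp
  also have "(\<Sum>i\<in>{1..l}. \<Sum>v\<in>{v\<in>V. \<phi> v = i}. x v) = (\<Sum>v\<in>V. x v)"
    using V \<phi> by (intro sum_over_parts) auto
  finally show ?thesis by (simp add: partite_density_def power_divide)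
qed

lemma card_colorable_le:
  assumes G: "kgraph k G" and col: "colorable (complete_pattern k l) G"
  shows "real (card (edges G)) \<le> partite_density k l * real (card (verts G)) ^ k"
proof -
  obtain \<phi> where "\<phi> ` verts G \<subseteq> {1..l}" "edges G \<subseteq> partite_edges k (verts G) \<phi>"
    using col colorable_complete_pattern[OF G] by blast
  then have "edge_sum (edges G) (\<lambda>_. 1) \<le> partite_density k l * (\<Sum>v\<in>verts G. 1) ^ k"
    using G by (intro edge_sum_partite_le) (auto simp: kgraph_def)
  then show ?thesis by (simp add: edge_sum_def)
qed

text \<open>By the power mean inequality, a nonnegative unit vector on \<open>n\<close> vertices has
  coordinate sum at most \<open>n powr (1 - 1 / \<alpha>)\<close>. Inserting this into
  \<open>edge_sum_partite_le\<close> gives the bound.\<close>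

lemma spectral_lambda_colorable_le:
  assumes G: "kgraph k G" and col: "colorable (complete_pattern k l) G" and ne: "verts G \<noteq> {}" and \<alpha>: "1 < \<alpha>"
  shows "spectral_lambda k \<alpha> G \<le> fact k * partite_density k l * real (card (verts G)) powr (real k - real k / \<alpha>)"
proof -
  define n where "n = real (card (verts G))"
  have fV: "finite (verts G)" using G by (simp add: kgraph_def)
  have n: "0 < n" using fV ne by (simp add: n_def card_gt_0_iff)
  obtain \<phi> where \<phi>: "\<phi> ` verts G \<subseteq> {1..l}" "edges G \<subseteq> partite_edges k (verts G) \<phi>"
    using col colorable_complete_pattern[OF G] by blast
  obtain x where x: "\<And>i. 0 \<le> x i" "(\<Sum>i\<in>verts G. x i powr \<alpha>) = 1"
    and lam: "spectral_lambda k \<alpha> G = fact k * edge_sum (edges G) x"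
    using spectral_lambda_attained[OF G ne, of \<alpha>] \<alpha> by (metis less_trans zero_less_one)
  define s where "s = (\<Sum>i\<in>verts G. x i)"
  have s0: "0 \<le> s" using x by (simp add: s_def sum_nonneg)
  have "n * (s / n) powr \<alpha> \<le> 1"
    using power_mean[OF \<alpha>, of "verts G" x] x by (simp add: n_def s_def)
  then have "(s / n) powr \<alpha> \<le> 1 / n" using n by (simp add: field_simps)
  then have "((s / n) powr \<alpha>) powr (1 / \<alpha>) \<le> (1 / n) powr (1 / \<alpha>)"
    using \<alpha> by (intro powr_mono2) auto
  then have "s / n \<le> n powr (- (1 / \<alpha>))"
    using \<alpha> s0 n by (simp add: powr_powr powr_minus_divide powr_divide)
  then have "s \<le> n powr 1 * n powr (- (1 / \<alpha>))" using n by (simp add: field_simps)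
  then have "s \<le> n powr (1 - 1 / \<alpha>)" using powr_add[of n 1 "- (1 / \<alpha>)"] by simp
  then have "s ^ k \<le> (n powr (1 - 1 / \<alpha>)) ^ k" using s0 by (intro power_mono) auto
  also have "\<dots> = n powr (real k - real k / \<alpha>)"
    using n by (simp add: powr_realpow[symmetric] powr_powr algebra_simps)
  finally have sk: "s ^ k \<le> n powr (real k - real k / \<alpha>)" .
  have "edge_sum (edges G) x \<le> partite_density k l * s ^ k"
    unfolding s_def using fV \<phi> x by (intro edge_sum_partite_le) auto
  also have "\<dots> \<le> partite_density k l * n powr (real k - real k / \<alpha>)"
    using sk by (intro mult_left_mono) (auto simp: partite_density_def)
  finally show ?thesis unfolding lam n_def by simp
qed

text \<open>Shifting the residues by one places the colors in \<open>{1..l}\<close>, the color set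
  of \<open>complete_pattern\<close>.\<close>

lemma turan_graph_eq:
  "turan_graph k l n = ({..<n}, partite_edges k {..<n} (\<lambda>v. Suc (v mod l)))"
  by (auto simp: turan_graph_def partite_edges_def inj_on_def)

lemma turan_coloring_image: "0 < l \<Longrightarrow> (\<lambda>v. Suc (v mod l)) ` A \<subseteq> {1..l}"
  by (auto simp: Suc_le_eq)

lemma kgraph_turan_graph: "kgraph k (turan_graph k l n)"
  by (auto simp: kgraph_def turan_graph_def)

lemma colorable_turan_graph: "0 < l \<Longrightarrow> colorable (complete_pattern k l) (turan_graph k l n)"
  using turan_coloring_image[of l "{..<n}"]
  by (subst colorable_complete_pattern[OF kgraph_turan_graph]) (auto simp: turan_graph_eq)

text \<open>A residue class is counted by the quotients \<open>t\<close> in \<open>?T\<close>. If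
  \<open>Suc t\<close> is a quotient for one residue, then \<open>t\<close> is one for any other,
  since two residues differ by less than \<open>l\<close>.\<close>

lemma balanced_turan_coloring:
  assumes l: "0 < l"
  shows "balanced_on {..<n} {1..l} (\<lambda>v. Suc (v mod l))"
  unfolding balanced_on_def
proof (intro ballI)
  let ?T = "\<lambda>i. {t. t * l + i < n}"
  have fT: "finite (?T i)" for i
  proof (rule finite_subset)
    have "t \<le> t * l" for t using l by simp
    then show "?T i \<subseteq> {..n}"
      by (metis (no_types, lifting) add_leE atMost_iff less_imp_le mem_Collect_eq order_trans subsetI)
  qed simp
  have card: "card {v\<in>{..<n}. Suc (v mod l) = Suc i} = card (?T i)" if i: "i < l" for i
  proof -
    have "{v\<in>{..<n}. Suc (v mod l) = Suc i} = (\<lambda>t. t * l + i) ` ?T i"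
    proof (intro equalityI subsetI)
      fix v assume "v \<in> {v\<in>{..<n}. Suc (v mod l) = Suc i}"
      then have "v = (v div l) * l + i" "v < n" using div_mult_mod_eq[of v l] by auto
      then show "v \<in> (\<lambda>t. t * l + i) ` ?T i" by (intro image_eqI[of _ _ "v div l"]) auto
    qed (use i in auto)
    moreover have "inj_on (\<lambda>t. t * l + i) (?T i)" using l by (auto intro: inj_onI)
    ultimately show ?thesis by (simp only: card_image)
  qed
  fix i' j' assume "i' \<in> {1..l}" "j' \<in> {1..l}"
  then obtain i j where ij: "i' = Suc i" "j' = Suc j" "i < l" "j < l"
    by (metis Suc_le_D Suc_le_lessD atLeastAtMost_iff One_nat_def)
  have "?T i \<subseteq> insert 0 (Suc ` ?T j)"
  proof
    fix t assume t: "t \<in> ?T i"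
    show "t \<in> insert 0 (Suc ` ?T j)"
      using t ij by (cases t) auto
  qed
  then have "card (?T i) \<le> card (insert 0 (Suc ` ?T j))" using fT by (intro card_mono) auto
  also have "\<dots> \<le> card (?T j) + 1"
    using fT card_insert_le_m1[of 1] by (simp add: card_insert_if card_image)
  finally show "card {v\<in>{..<n}. Suc (v mod l) = i'} \<le> card {v\<in>{..<n}. Suc (v mod l) = j'} + 1"
    using card ij by simp
qed

text \<open>The edge count is the elementary symmetric sum of the part sizes, each of which is
  \<open>q\<close> or \<open>q + 1\<close>, so \<open>esym_near_const_ge\<close> applies.\<close>

lemma card_edges_turan_graph_ge:
  assumes l: "0 < l" and k: "0 < k" and n: "l \<le> n"
  shows "partite_density k l * real n ^ k * (1 - (real (k - 1) * real l / real n)\<^sup>2)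
    \<le> real (card (edges (turan_graph k l n)))"
proof -
  let ?\<phi> = "\<lambda>v. Suc (v mod l)" and ?L = "{1..l}"
  let ?n = "\<lambda>i. card {v\<in>{..<n}. Suc (v mod l) = i}"
  define q where "q = n div l"
  have q: "0 < q" using l n by (simp add: q_def div_greater_zero_iff)
  have \<phi>L: "?\<phi> ` {..<n} \<subseteq> ?L" using turan_coloring_image[OF l] .
  have ne: "?L \<noteq> {}" using l by auto
  note sz = balanced_on_part_sizes[OF _ _ ne \<phi>L balanced_turan_coloring[OF l], simplified card_lessThan card_atLeastAtMost diff_Suc_1, folded q_def]
  define a where "a i = real (?n i) - real q" for i
  have a01: "a i = 0 \<or> a i = 1" if "i \<in> ?L" for i
    using sz(1)[of i] that by (auto simp: a_def)
  have sumn: "(\<Sum>i\<in>?L. real (?n i)) = real n"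
    using sum_over_parts[of "{..<n}" ?L ?\<phi> "\<lambda>_. 1::real"] \<phi>L by simp
  obtain j where kj: "k = Suc j" using k gr0_implies_Suc by blast
  have "real (card (edges (turan_graph k l n))) = (\<Sum>e\<in>partite_edges k {..<n} ?\<phi>. \<Prod>v\<in>e. (1::real))"
    by (simp add: turan_graph_eq)
  also have "\<dots> = esym k ?L (\<lambda>i. \<Sum>v\<in>{v\<in>{..<n}. ?\<phi> v = i}. 1)"
    using \<phi>L by (intro sum_partite_edges) auto
  also have "\<dots> = esym (Suc j) ?L (\<lambda>i. real q + a i)"
    by (simp add: a_def kj)
  finally have cE: "real (card (edges (turan_graph k l n))) = esym (Suc j) ?L (\<lambda>i. real q + a i)" .
  have "real (l choose Suc j) * (real n / real l) ^ Suc j * (1 - (real j * real l / real n)\<^sup>2)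
    \<le> esym (Suc j) ?L (\<lambda>i. real q + a i)"
  proof (rule esym_near_const_ge)
    show "0 \<le> a i" if "i \<in> ?L" for i using a01[OF that] by auto
    have "(\<Sum>i\<in>?L. a i) \<le> (\<Sum>i\<in>?L. 1)" using a01 by (intro sum_mono) fastforce
    then show "(\<Sum>i\<in>?L. a i) \<le> real l" by simp
    show "real n = real l * real q + (\<Sum>i\<in>?L. a i)"
      using sumn by (simp add: a_def sum_subtractf)
  qed (use l q in auto)
  then show ?thesis unfolding cE unfolding kj partite_density_def by (simp add: power_divide)
qed

text \<open>Infinitely many graphs compete because their vertices may be any natural numbers, but
  their edge counts are bounded; this makes \<open>Max\<close> in \<open>ex_number\<close>
  meaningful.\<close>

lemma finite_edge_counts:
  "finite {card (edges H) | H. kgraph k H \<and> card (verts H) = n \<and> free_of \<F> H}"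
proof (rule finite_subset)
  show "{card (edges H) | H. kgraph k H \<and> card (verts H) = n \<and> free_of \<F> H} \<subseteq> {..2 ^ n}"
  proof
    fix c assume "c \<in> {card (edges H) | H. kgraph k H \<and> card (verts H) = n \<and> free_of \<F> H}"
    then obtain H where H: "kgraph k H" "card (verts H) = n" "c = card (edges H)" by blast
    then have "edges H \<subseteq> Pow (verts H)" "finite (verts H)" by (auto simp: kgraph_def)
    then have "card (edges H) \<le> card (Pow (verts H))" by (intro card_mono) auto
    then show "c \<in> {..2 ^ n}" using H \<open>finite (verts H)\<close> by (simp add: card_Pow)
  qed
qed simp

text \<open>The two halves of the Turan pair: the Turan graph is colorable, hence free, and an
  extremal graph is colorable, hence has few edges.\<close>

lemma ex_number_bounds:
  assumes l: "0 < l" and tp: "turan_pair k \<F> (complete_pattern k l)"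
  shows "card (edges (turan_graph k l n)) \<le> ex_number k n \<F>"
    and "real (ex_number k n \<F>) \<le> partite_density k l * real n ^ k"
proof -
  let ?S = "{card (edges H) | H. kgraph k H \<and> card (verts H) = n \<and> free_of \<F> H}"
  have fS: "finite ?S" by (rule finite_edge_counts)
  have "free_of \<F> (turan_graph k l n)"
    using tp kgraph_turan_graph colorable_turan_graph[OF l] unfolding turan_pair_def by blast
  then have T: "card (edges (turan_graph k l n)) \<in> ?S"
    using kgraph_turan_graph[of k l n] by (intro CollectI exI[of _ "turan_graph k l n"]) (auto simp: turan_graph_eq)
  then show "card (edges (turan_graph k l n)) \<le> ex_number k n \<F>"
    unfolding ex_number_def using fS by (intro Max_ge)
  have "ex_number k n \<F> \<in> ?S"
    unfolding ex_number_def using fS T by (intro Max_in) auto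
  then obtain H where H: "kgraph k H" "card (verts H) = n" "free_of \<F> H" "card (edges H) = ex_number k n \<F>"
    by (smt (verit) mem_Collect_eq)
  then have "colorable (complete_pattern k l) H"
    using tp unfolding turan_pair_def by blast
  then show "real (ex_number k n \<F>) \<le> partite_density k l * real n ^ k"
    using card_colorable_le[OF H(1)] H by metis
qed

lemma binomial_over_power_tendsto: "(\<lambda>n. real (n choose k) / real n ^ k) \<longlonglongrightarrow> 1 / fact k"
proof -
  have "(\<lambda>n. (\<Prod>i<k. 1 - real i / real n) / fact k) \<longlonglongrightarrow> (\<Prod>i<k. 1 - 0) / fact k"
    by (intro tendsto_intros lim_const_over_n) simp
  moreover have "\<forall>\<^sub>F n in sequentially. (\<Prod>i<k. 1 - real i / real n) / fact k = real (n choose k) / real n ^ k"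
  proof (rule eventually_sequentiallyI[of 1])
    fix n :: nat assume n: "1 \<le> n"
    have "(\<Prod>i<k. 1 - real i / real n) = (\<Prod>i<k. (real n - real i) / real n)"
      using n by (intro prod.cong) (auto simp: field_simps)
    also have "\<dots> = (\<Prod>i<k. real n - real i) / real n ^ k"
      by (simp add: prod_dividef)
    finally show "(\<Prod>i<k. 1 - real i / real n) / fact k = real (n choose k) / real n ^ k"
      by (simp add: binomial_gbinomial gbinomial_prod_rev atLeast0LessThan)
  qed
  ultimately show ?thesis using Lim_transform_eventually by fastforce
qed

text \<open>Both bounds on \<open>ex_number\<close>, divided by the power of \<open>n\<close>,
  converge to \<open>partite_density k l\<close>. In particular the limit defining the density
  exists.\<close>

lemma turan_density_eq:
  assumes l: "0 < l" and k: "0 < k" and tp: "turan_pair k \<F> (complete_pattern k l)"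
  shows "turan_density k \<F> = fact k * partite_density k l"
proof -
  let ?A = "partite_density k l"
  have "(\<lambda>n. real (ex_number k n \<F>) / real n ^ k) \<longlonglongrightarrow> ?A"
  proof (rule tendsto_sandwich)
    have "(\<lambda>n. ?A * (1 - (real (k - 1) * real l / real n)\<^sup>2)) \<longlonglongrightarrow> ?A * (1 - 0\<^sup>2)"
      by (intro tendsto_intros lim_const_over_n[of "real (k - 1) * real l"])
    then show "(\<lambda>n. ?A * (1 - (real (k - 1) * real l / real n)\<^sup>2)) \<longlonglongrightarrow> ?A" by simp
    show "\<forall>\<^sub>F n in sequentially. ?A * (1 - (real (k - 1) * real l / real n)\<^sup>2) \<le> real (ex_number k n \<F>) / real n ^ k"
    proof (rule eventually_sequentiallyI[of l])
      fix n assume n: "l \<le> n"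
      have "?A * real n ^ k * (1 - (real (k - 1) * real l / real n)\<^sup>2) \<le> real (ex_number k n \<F>)"
        using card_edges_turan_graph_ge[OF l k n] ex_number_bounds(1)[OF l tp, of n] by linarith
      then show "?A * (1 - (real (k - 1) * real l / real n)\<^sup>2) \<le> real (ex_number k n \<F>) / real n ^ k"
        using n l by (subst le_divide_eq) (auto simp: mult_ac)
    qed
    show "\<forall>\<^sub>F n in sequentially. real (ex_number k n \<F>) / real n ^ k \<le> ?A"
    proof (rule eventually_sequentiallyI[of 1])
      fix n :: nat assume "1 \<le> n"
      then show "real (ex_number k n \<F>) / real n ^ k \<le> ?A"
        using ex_number_bounds(2)[OF l tp, of n] by (simp add: divide_le_eq)
    qed
  qed simp
  then have "(\<lambda>n. (real (ex_number k n \<F>) / real n ^ k) / (real (n choose k) / real n ^ k)) \<longlonglongrightarrow> ?A / (1 / fact k)"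
    using binomial_over_power_tendsto by (rule tendsto_divide) simp
  moreover have "\<forall>\<^sub>F n in sequentially. (real (ex_number k n \<F>) / real n ^ k) / (real (n choose k) / real n ^ k)
      = real (ex_number k n \<F>) / real (n choose k)"
    by (rule eventually_sequentiallyI[of 1]) simp
  ultimately have "(\<lambda>n. real (ex_number k n \<F>) / real (n choose k)) \<longlonglongrightarrow> ?A / (1 / fact k)"
    by (rule Lim_transform_eventually)
  then show ?thesis unfolding turan_density_def by (simp add: limI mult.commute)
qed

text \<open>The all-ones vector in the homogeneous inequality reduces the claim to the edge
  count.\<close>

lemma spectral_lambda_turan_graph_ge:
  assumes l: "0 < l" and k: "0 < k" and n: "l \<le> n" and \<alpha>: "1 < \<alpha>"
  shows "fact k * partite_density k l * real n powr (real k - real k / \<alpha>)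
      * (1 - (real (k - 1) * real l / real n)\<^sup>2) \<le> spectral_lambda k \<alpha> (turan_graph k l n)"
proof -
  let ?T = "turan_graph k l n"
  have n0: "0 < real n" using l n by simp
  have vT: "verts ?T = {..<n}" by (simp add: turan_graph_eq)
  have "fact k * edge_sum (edges ?T) (\<lambda>_. 1)
      \<le> spectral_lambda k \<alpha> ?T * (\<Sum>i\<in>verts ?T. 1 powr \<alpha>) powr (real k / \<alpha>)"
    using \<alpha> k kgraph_turan_graph by (intro edge_sum_le_spectral_lambda) auto
  then have "fact k * real (card (edges ?T)) \<le> spectral_lambda k \<alpha> ?T * real n powr (real k / \<alpha>)"
    by (simp add: edge_sum_def vT)
  moreover have "fact k * (partite_density k l * real n ^ k * (1 - (real (k - 1) * real l / real n)\<^sup>2))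
      \<le> fact k * real (card (edges ?T))"
    using card_edges_turan_graph_ge[OF l k n] by (intro mult_left_mono) auto
  moreover have "real n ^ k = real n powr (real k - real k / \<alpha>) * real n powr (real k / \<alpha>)"
    using n0 by (simp add: powr_add[symmetric] powr_realpow)
  then have "(fact k * partite_density k l * real n powr (real k - real k / \<alpha>)
      * (1 - (real (k - 1) * real l / real n)\<^sup>2)) * real n powr (real k / \<alpha>)
      = fact k * (partite_density k l * real n ^ k * (1 - (real (k - 1) * real l / real n)\<^sup>2))"
    by (simp only: mult_ac)
  ultimately have "(fact k * partite_density k l * real n powr (real k - real k / \<alpha>)
      * (1 - (real (k - 1) * real l / real n)\<^sup>2)) * real n powr (real k / \<alpha>)
      \<le> spectral_lambda k \<alpha> ?T * real n powr (real k / \<alpha>)"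
    by linarith
  then show ?thesis using n0 by simp
qed

section \<open>Deleting light vertices\<close>

text \<open>Both sides are compared with \<open>1 / (1 + z)\<close>; the product of
  \<open>1 + z\<close> and the right side is \<open>1 + z ^ 3\<close>.\<close>

lemma exp_minus_le_quadratic:
  fixes z :: real
  assumes "0 \<le> z"
  shows "exp (- z) \<le> 1 - z + z\<^sup>2"
proof -
  have "(1 + z) * (1 - z + z\<^sup>2) = 1 + z ^ 3" by algebra
  then have "1 / (1 + z) \<le> 1 - z + z\<^sup>2"
    using assms by (simp add: divide_le_eq mult.commute)
  moreover have "exp (- z) \<le> 1 / (1 + z)"
    using assms exp_ge_add_one_self[of z] by (simp add: exp_minus divide_simps)
  ultimately show ?thesis by linarith
qed

lemma one_minus_powr_le_exp:
  fixes a t :: real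
  assumes "0 \<le> a" "t < 1"
  shows "(1 - t) powr a \<le> exp (- (a * t))"
proof -
  have "ln (1 - t) \<le> - t" using ln_le_minus_one[of "1 - t"] assms by simp
  then have "a * ln (1 - t) \<le> a * (- t)" using assms by (intro mult_left_mono) auto
  then show ?thesis using assms by (simp add: powr_def)
qed

text \<open>The point is that the exponent \<open>\<beta> (1 - \<delta>/2)\<close> is strictly smaller than the growth rate \<open>\<beta>\<close> of
  \<open>\<lambda>\<^sub>\<alpha>\<close> of the Turan graphs, so deleting a light vertex makes \<open>\<lambda>\<^sub>\<alpha>(G) / m\<^sup>\<beta>\<close> larger.\<close>

lemma deletion_estimate:
  fixes \<alpha> \<delta> t :: real and k m :: nat
  defines "\<beta> \<equiv> real k - real k / \<alpha>"
  assumes \<alpha>: "1 < \<alpha>" and k: "0 < k" and \<delta>: "0 < \<delta>" "\<delta> < 1" and t: "0 \<le> t" "t \<le> (1 - \<delta>) / real m"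
    and m: "2 \<le> m" "8 * (real k)\<^sup>2 / (\<beta> * \<delta>) \<le> real m"
  shows "(1 - 1 / real m) powr (\<beta> * (1 - \<delta> / 2)) * (1 - t) powr (real k / \<alpha>) \<le> 1 - real k * t"
proof -
  define c where "c = \<beta> * (1 - \<delta> / 2)"
  define z where "z = real k / \<alpha> * t + c * (1 / real m)"
  have ka: "0 < real k / \<alpha>" "real k / \<alpha> < real k" using k \<alpha> by (auto simp: divide_less_eq)
  have \<beta>: "0 < \<beta>" "\<beta> \<le> real k" using ka by (auto simp: \<beta>_def)
  have c0: "0 \<le> c" using \<beta> \<delta> by (simp add: c_def)
  have ck: "c \<le> real k"
    using mult_mono[of \<beta> "real k" "1 - \<delta> / 2" 1] \<beta> \<delta> by (simp add: c_def)
  have m0: "0 < real m" using m by simp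
  have tm: "t \<le> 1 / real m" using t(2) \<delta> m0 by (smt (verit) divide_right_mono)
  have m1: "1 / real m < 1" using m by simp
  have z0: "0 \<le> z" unfolding z_def using ka c0 t m0 by (intro add_nonneg_nonneg mult_nonneg_nonneg) auto
  have "z \<le> real k * (1 / real m) + real k * (1 / real m)"
    unfolding z_def using ka ck c0 tm t m0 by (intro add_mono mult_mono) auto
  then have zm: "z \<le> 2 * real k / real m" by simp
  have "(1 - 1 / real m) powr c * (1 - t) powr (real k / \<alpha>)
      \<le> exp (- (c * (1 / real m))) * exp (- (real k / \<alpha> * t))"
    using c0 ka m1 tm by (intro mult_mono one_minus_powr_le_exp) auto
  also have "\<dots> = exp (- z)" by (simp add: z_def exp_add[symmetric])
  also have "\<dots> \<le> 1 - z + z\<^sup>2" using z0 by (rule exp_minus_le_quadratic)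
  also have "\<dots> \<le> 1 - z + (2 * real k / real m)\<^sup>2"
    using zm z0 by (intro add_left_mono power_mono) auto
  also have "\<dots> \<le> 1 - real k * t"
  proof -
    \<comment> \<open>Half of the lightness \<open>\<delta>\<close> is spent in the exponent
      \<open>c\<close>; the other half remains as a surplus of order \<open>1 / m\<close>.\<close>
    have "\<beta> * t \<le> \<beta> * ((1 - \<delta>) / real m)" using \<beta> t by (intro mult_left_mono) auto
    also have "\<dots> = c * (1 / real m) - \<beta> * \<delta> / 2 / real m"
      using m0 by (simp add: c_def field_simps)
    finally have 1: "\<beta> * t \<le> c * (1 / real m) - \<beta> * \<delta> / 2 / real m" .
    \<comment> \<open>The lower bound on \<open>m\<close> is what lets that surplus absorb the
      quadratic error.\<close>
    have "8 * (real k)\<^sup>2 \<le> real m * (\<beta> * \<delta>)"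
      using m(2) \<beta> \<delta> by (simp add: divide_le_eq)
    then have "4 * (real k)\<^sup>2 / (real m)\<^sup>2 \<le> (real m * (\<beta> * \<delta>) / 2) / (real m)\<^sup>2"
      by (intro divide_right_mono) auto
    also have "\<dots> = \<beta> * \<delta> / 2 / real m" using m0 by (simp add: power2_eq_square)
    finally have 2: "(2 * real k / real m)\<^sup>2 \<le> \<beta> * \<delta> / 2 / real m"
      by (simp add: power_divide power_mult_distrib)
    have "real k * t = \<beta> * t + real k / \<alpha> * t" by (simp add: \<beta>_def algebra_simps)
    then show ?thesis using 1 2 by (simp add: z_def)
  qed
  finally show ?thesis by (simp add: c_def)
qed

section \<open>Flat vectors, minimum degree and degree-stability\<close>

lemma card_subsets_le_power:
  assumes "finite V"
  shows "real (card {K. K \<subseteq> V \<and> card K = j}) \<le> real (card V) ^ j"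
proof -
  have "real (card V choose j) \<le> real (card V) ^ j"
  proof (cases "j \<le> card V")
    case True
    then show ?thesis using binomial_le_pow of_nat_mono by fastforce
  qed (simp add: binomial_eq_0)
  then show ?thesis using assms by (simp add: n_subsets)
qed

text \<open>After rescaling by \<open>M\<close> the coordinates are at most \<open>1 + u i\<close>
  with small total excess, so the rescaled link sum exceeds the degree by little. The Lagrange
  condition bounds the link sum from below.\<close>

lemma degree_ge_of_flat_vector:
  assumes G: "kgraph k G" and k: "0 < k" and \<alpha>: "1 < \<alpha>" and \<delta>: "0 < \<delta>" "\<delta> < 1" and p: "0 < p"
    and x: "\<And>i. 0 \<le> x i" "(\<Sum>i\<in>verts G. x i powr \<alpha>) = 1"
    and lam: "spectral_lambda k \<alpha> G = fact k * edge_sum (edges G) x"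
    and flat: "\<And>i. i \<in> verts G \<Longrightarrow> (1 - \<delta>) / real (card (verts G)) \<le> x i powr \<alpha>"
    and large: "(1 - \<delta>) * (p * real (card (verts G)) powr (real k - real k / \<alpha>)) \<le> spectral_lambda k \<alpha> G"
    and v: "v \<in> verts G"
  shows "((1 - \<delta>) * (1 - \<delta>) powr ((\<alpha> - 1) / \<alpha>) * p / fact (k - 1) - ((1 + \<delta>) ^ (k - 1) - 1))
      * real (card (verts G)) ^ (k - 1) \<le> real (vertex_degree G v)"
proof -
  define m where "m = real (card (verts G))"
  define S where "S = link_sum (edges G) x v"
  define M where "M = m powr (1 / \<alpha>)"
  \<comment> \<open>The excess over the guaranteed minimum: nonnegative by flatness, with total
    \<open>\<delta> * m\<close> by the normalisation.\<close>
  define u where "u i = m * x i powr \<alpha> - (1 - \<delta>)" for i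
  let ?E = "{e\<in>edges G. v \<in> e}" and ?F = "{f. f \<subseteq> verts G \<and> card f = k - 1}"
  have fV: "finite (verts G)" using G by (simp add: kgraph_def)
  have m0: "0 < m" using fV v by (auto simp: m_def card_gt_0_iff)
  have M0: "0 < M" using m0 by (simp add: M_def)
  have fE: "finite ?E" using kgraph_finite_edges[OF G] by simp
  have fF: "finite ?F" using finite_card_subsets[OF fV] .
  have xpos: "0 < x i" if "i \<in> verts G" for i
  proof -
    have "0 < (1 - \<delta>) / m" using \<delta> m0 by simp
    then have "0 < x i powr \<alpha>" using flat[OF that] unfolding m_def by linarith
    then show ?thesis using x(1)[of i] by (cases "x i = 0") auto
  qed
  have u0: "0 \<le> u i" if "i \<in> verts G" for i
    using flat[OF that] m0 by (simp add: u_def m_def divide_le_eq mult.commute)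
  have "(\<Sum>i\<in>verts G. u i) = m * (\<Sum>i\<in>verts G. x i powr \<alpha>) - m * (1 - \<delta>)"
    by (simp add: u_def sum_subtractf sum_distrib_left m_def)
  then have sumu: "(\<Sum>i\<in>verts G. u i) = \<delta> * m"
    using x(2) by (simp add: algebra_simps)
  have z: "M * x i \<le> 1 + u i" if i: "i \<in> verts G" for i
  proof -
    have "M * x i = (m * x i powr \<alpha>) powr (1 / \<alpha>)"
      using m0 xpos[OF i] \<alpha> by (simp add: M_def powr_mult powr_powr)
    also have "\<dots> \<le> (1 + u i) powr (1 / \<alpha>)"
      using \<delta> \<alpha> m0 xpos[OF i] by (intro powr_mono2) (auto simp: u_def)
    also have "\<dots> \<le> (1 + u i) powr 1"
      using u0[OF i] \<alpha> by (intro powr_mono) auto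
    finally show ?thesis using u0[OF i] by simp
  qed
  have inj: "inj_on (\<lambda>e. e - {v}) ?E" by (rule inj_onI) blast
  have imF: "(\<lambda>e. e - {v}) ` ?E \<subseteq> ?F"
    using G kgraph_finite_edge[OF G] by (auto simp: kgraph_def)
  have prod1: "1 \<le> (\<Prod>i\<in>f. 1 + u i)" if "f \<in> ?F" for f
    using that u0 by (intro prod_ge_1) auto
  have "M ^ (k - 1) * S = (\<Sum>e\<in>?E. \<Prod>i\<in>e - {v}. M * x i)"
    unfolding S_def link_sum_def sum_distrib_left
  proof (rule sum.cong[OF refl])
    fix e assume e: "e \<in> ?E"
    then have "card (e - {v}) = k - 1" using imF by blast
    then show "M ^ (k - 1) * (\<Prod>i\<in>e - {v}. x i) = (\<Prod>i\<in>e - {v}. M * x i)"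
      by (simp add: prod.distrib)
  qed
  also have "\<dots> \<le> (\<Sum>e\<in>?E. \<Prod>i\<in>e - {v}. 1 + u i)"
  proof (intro sum_mono prod_mono conjI)
    fix e i assume "e \<in> ?E" "i \<in> e - {v}"
    then have "i \<in> verts G" using G by (auto simp: kgraph_def)
    then show "0 \<le> M * x i" "M * x i \<le> 1 + u i" using z M0 x(1)[of i] by auto
  qed
  also have "\<dots> = real (vertex_degree G v) + (\<Sum>e\<in>?E. (\<Prod>i\<in>e - {v}. 1 + u i) - 1)"
    by (simp add: sum_subtractf vertex_degree_def)
  also have "(\<Sum>e\<in>?E. (\<Prod>i\<in>e - {v}. 1 + u i) - 1) = (\<Sum>f\<in>(\<lambda>e. e - {v}) ` ?E. (\<Prod>i\<in>f. 1 + u i) - 1)"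
    using inj by (simp add: sum.reindex)
  \<comment> \<open>Subtracting 1 leaves nonnegative terms, so the sum may be extended from the link
    to all \<open>(k - 1)\<close>-sets, where Maclaurin's inequality with mean
    \<open>1 + \<delta>\<close> applies.\<close>
  also have "\<dots> \<le> (\<Sum>f\<in>?F. (\<Prod>i\<in>f. 1 + u i) - 1)"
    using fF imF prod1 by (intro sum_mono2) auto
  also have "\<dots> = esym (k - 1) (verts G) (\<lambda>i. 1 + u i) - real (card ?F)"
    by (simp add: esym_def sum_subtractf)
  also have "\<dots> \<le> real (card ?F) * (1 + \<delta>) ^ (k - 1) - real (card ?F)"
  proof -
    have "(\<Sum>i\<in>verts G. 1 + u i) / m = 1 + \<delta>"
      using m0 sumu by (simp add: sum.distrib field_simps m_def)
    then show ?thesis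
      using maclaurin_esym[OF fV, of "\<lambda>i. 1 + u i" "k - 1"] u0 n_subsets[OF fV, of "k - 1"]
      by (simp add: m_def add_nonneg_nonneg)
  qed
  also have "\<dots> = real (card ?F) * ((1 + \<delta>) ^ (k - 1) - 1)" by (simp add: algebra_simps)
  also have "\<dots> \<le> m ^ (k - 1) * ((1 + \<delta>) ^ (k - 1) - 1)"
    using card_subsets_le_power[OF fV, of "k - 1"] \<delta> by (intro mult_right_mono) (auto simp: m_def)
  finally have upper: "M ^ (k - 1) * S \<le> real (vertex_degree G v) + m ^ (k - 1) * ((1 + \<delta>) ^ (k - 1) - 1)"
    by simp
  have "(1 - \<delta>) * (1 - \<delta>) powr ((\<alpha> - 1) / \<alpha>) * p * m ^ (k - 1)
      = M ^ (k - 1) * ((1 - \<delta>) * (p * m powr (real k - real k / \<alpha>)) * ((1 - \<delta>) / m) powr ((\<alpha> - 1) / \<alpha>))"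
  proof -
    have rk: "real (k - 1) = real k - 1" using k by (simp add: of_nat_diff)
    have M1: "M ^ (k - 1) = m powr ((real k - 1) / \<alpha>)"
      using m0 M0 rk by (simp add: M_def powr_realpow[symmetric] powr_powr)
    have m1: "m ^ (k - 1) = m powr (real k - 1)"
      using m0 rk by (simp add: powr_realpow[symmetric])
    \<comment> \<open>The exponents of \<open>m\<close> from the rescaling, from the size of the
      eigenvalue and from the flatness bound add up to the order of a degree.\<close>
    have "(real k - 1) / \<alpha> + (real k - real k / \<alpha>) + - ((\<alpha> - 1) / \<alpha>) = real k - 1"
      using \<alpha> by (simp add: field_simps)
    then have mm: "m powr ((real k - 1) / \<alpha>) * m powr (real k - real k / \<alpha>) * m powr (- ((\<alpha> - 1) / \<alpha>)) = m powr (real k - 1)"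
      by (simp only: powr_add[symmetric])
    have dm: "((1 - \<delta>) / m) powr ((\<alpha> - 1) / \<alpha>) = (1 - \<delta>) powr ((\<alpha> - 1) / \<alpha>) * m powr (- ((\<alpha> - 1) / \<alpha>))"
      using \<delta> m0 by (simp add: powr_divide powr_minus_divide)
    show ?thesis unfolding M1 m1 dm mm[symmetric] by (simp only: mult_ac)
  qed
  also have "\<dots> \<le> M ^ (k - 1) * (spectral_lambda k \<alpha> G * x v powr (\<alpha> - 1))"
  proof -
    have "((1 - \<delta>) / m) powr ((\<alpha> - 1) / \<alpha>) \<le> (x v powr \<alpha>) powr ((\<alpha> - 1) / \<alpha>)"
      using flat[OF v] \<delta> m0 \<alpha> by (intro powr_mono2) (auto simp: m_def)
    also have "\<dots> = x v powr (\<alpha> - 1)" using \<alpha> by (simp add: powr_powr)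
    finally show ?thesis
      using large M0 p \<delta> m0 by (intro mult_left_mono mult_mono) (auto simp: m_def intro: order_trans[rotated])
  qed
  also have "\<dots> = fact (k - 1) * (M ^ (k - 1) * S)"
    using eigen_equation[OF G k \<alpha> x lam v xpos[OF v]] by (simp add: S_def)
  also have "\<dots> \<le> fact (k - 1) * (real (vertex_degree G v) + m ^ (k - 1) * ((1 + \<delta>) ^ (k - 1) - 1))"
    using upper by (intro mult_left_mono) auto
  finally have "(1 - \<delta>) * (1 - \<delta>) powr ((\<alpha> - 1) / \<alpha>) * p * m ^ (k - 1) / fact (k - 1)
      \<le> real (vertex_degree G v) + m ^ (k - 1) * ((1 + \<delta>) ^ (k - 1) - 1)"
    by (simp add: divide_le_eq mult.commute)
  then show ?thesis by (simp add: m_def algebra_simps)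
qed

text \<open>As \<delta> tends to 0 from the right, the degree coefficient of
  \<open>degree_ge_of_flat_vector\<close> tends to \<open>p / fact j\<close>.\<close>

lemma exists_flatness_threshold:
  fixes \<alpha> \<epsilon> p :: real
  assumes \<epsilon>: "0 < \<epsilon>"
  obtains \<delta> where "0 < \<delta>" "\<delta> < 1"
    "p / fact j - \<epsilon> \<le> (1 - \<delta>) * (1 - \<delta>) powr ((\<alpha> - 1) / \<alpha>) * p / fact j - ((1 + \<delta>) ^ j - 1)"
proof -
  let ?f = "\<lambda>\<delta>::real. (1 - \<delta>) * (1 - \<delta>) powr ((\<alpha> - 1) / \<alpha>) * p / fact j - ((1 + \<delta>) ^ j - 1)"
  have "(?f \<longlongrightarrow> (1 - 0) * (1 - 0) powr ((\<alpha> - 1) / \<alpha>) * p / fact j - ((1 + 0) ^ j - 1)) (at_right 0)"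
    by (intro tendsto_intros) auto
  then have "(?f \<longlongrightarrow> p / fact j) (at_right 0)" by simp
  then have "\<forall>\<^sub>F \<delta> in at_right 0. p / fact j - \<epsilon> < ?f \<delta>"
    using \<epsilon> by (intro order_tendstoD) auto
  moreover have "\<forall>\<^sub>F \<delta>::real in at_right 0. \<delta> \<in> {0<..<1}"
    by (rule eventually_at_right_real) simp
  ultimately have "\<forall>\<^sub>F \<delta> in at_right 0. p / fact j - \<epsilon> < ?f \<delta> \<and> \<delta> \<in> {0<..<1}"
    by (rule eventually_conj)
  from eventually_happens[OF this] obtain \<delta> where "p / fact j - \<epsilon> < ?f \<delta>" "\<delta> \<in> {0<..<1}"
    using trivial_limit_at_right_real[of "0::real"] by blast
  then show ?thesis using that[of \<delta>] by auto
qed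

text \<open>Combine \<open>spectral_lambda_delete_vertex\<close> with
  \<open>deletion_estimate\<close>. The common factor
  \<open>(1 - t) powr (real k / \<alpha>)\<close> cancels because a light vertex has
  \<open>t < 1\<close>.\<close>

lemma spectral_lambda_delete_light_vertex:
  fixes \<alpha> \<delta> :: real and k :: nat
  defines "\<beta> \<equiv> real k - real k / \<alpha>"
  assumes G: "kgraph k G" and k: "0 < k" and \<alpha>: "1 < \<alpha>" and \<delta>: "0 < \<delta>" "\<delta> < 1"
    and x: "\<And>i. 0 \<le> x i" "(\<Sum>i\<in>verts G. x i powr \<alpha>) = 1"
    and lam: "spectral_lambda k \<alpha> G = fact k * edge_sum (edges G) x"
    and v: "v \<in> verts G" and light: "x v powr \<alpha> \<le> (1 - \<delta>) / real m"
    and m: "card (verts G) = m" "2 \<le> m" "8 * (real k)\<^sup>2 / (\<beta> * \<delta>) \<le> real m"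
  shows "spectral_lambda k \<alpha> G
    \<le> (real m / real (m - 1)) powr (\<beta> * (1 - \<delta> / 2)) * spectral_lambda k \<alpha> (delete_vertex G v)"
proof -
  define c where "c = \<beta> * (1 - \<delta> / 2)"
  define t where "t = x v powr \<alpha>"
  have t0: "0 \<le> t" by (simp add: t_def)
  have "(1 - \<delta>) / real m \<le> 1 / real m" using \<delta> by (intro divide_right_mono) auto
  also have "\<dots> < 1" using m by simp
  finally have t1: "t < 1" using light by (simp add: t_def)
  have ne: "verts G \<noteq> {}" using v by blast
  have lam0: "0 \<le> spectral_lambda k \<alpha> G" using spectral_lambda_nonneg[OF G ne] \<alpha> by simp
  have "(1 - 1 / real m) powr c * (1 - t) powr (real k / \<alpha>) \<le> 1 - real k * t"
    unfolding c_def \<beta>_def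
    using \<alpha> k \<delta> t0 light m by (intro deletion_estimate) (auto simp: t_def \<beta>_def)
  then have "spectral_lambda k \<alpha> G * ((1 - 1 / real m) powr c * (1 - t) powr (real k / \<alpha>))
      \<le> spectral_lambda k \<alpha> G * (1 - real k * t)"
    using lam0 by (rule mult_left_mono)
  also have "\<dots> \<le> spectral_lambda k \<alpha> (delete_vertex G v) * (1 - t) powr (real k / \<alpha>)"
    using spectral_lambda_delete_vertex[OF G k \<alpha> x lam v] by (simp add: t_def)
  finally have "spectral_lambda k \<alpha> G * (1 - 1 / real m) powr c \<le> spectral_lambda k \<alpha> (delete_vertex G v)"
    using t1 by (simp add: mult.assoc[symmetric])
  moreover have "1 - 1 / real m = real (m - 1) / real m"
    using m by (simp add: of_nat_diff field_simps)
  ultimately have "spectral_lambda k \<alpha> G * (real (m - 1) / real m) powr c \<le> spectral_lambda k \<alpha> (delete_vertex G v)"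
    by simp
  then have "(real m / real (m - 1)) powr c * (spectral_lambda k \<alpha> G * (real (m - 1) / real m) powr c)
      \<le> (real m / real (m - 1)) powr c * spectral_lambda k \<alpha> (delete_vertex G v)"
    by (intro mult_left_mono) auto
  moreover have "(real m / real (m - 1)) powr c * (real (m - 1) / real m) powr c = 1"
    using m by (simp add: powr_mult[symmetric])
  then have "(real m / real (m - 1)) powr c * (spectral_lambda k \<alpha> G * (real (m - 1) / real m) powr c)
      = spectral_lambda k \<alpha> G"
    by (metis mult.left_commute mult.right_neutral)
  ultimately show ?thesis unfolding c_def[symmetric] by linarith
qed

text \<open>The flatness \<delta> is chosen from the \<epsilon> of degree-stability, so that the
  degree bound at a vertex of minimum degree meets the stability threshold.\<close>

lemma flat_vector_imp_colorable:
  assumes k: "2 \<le> k" "k \<le> l" and tp: "turan_pair k \<F> (complete_pattern k l)"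
    and ds: "degree_stable k \<F> (Col k (complete_pattern k l))" and \<alpha>: "1 < \<alpha>"
  obtains \<delta> N where "0 < \<delta>" "\<delta> < 1"
    "\<And>G x. kgraph k G \<Longrightarrow> free_of \<F> G \<Longrightarrow> N \<le> card (verts G) \<Longrightarrow> verts G \<noteq> {} \<Longrightarrow> \<forall>i. 0 \<le> x i \<Longrightarrow>
      (\<Sum>i\<in>verts G. x i powr \<alpha>) = 1 \<Longrightarrow> spectral_lambda k \<alpha> G = fact k * edge_sum (edges G) x \<Longrightarrow>
      \<forall>i\<in>verts G. (1 - \<delta>) / real (card (verts G)) \<le> x i powr \<alpha> \<Longrightarrow>
      (1 - \<delta>) * (fact k * partite_density k l * real (card (verts G)) powr (real k - real k / \<alpha>)) \<le> spectral_lambda k \<alpha> G \<Longrightarrow>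
      colorable (complete_pattern k l) G"
proof -
  define p where "p = fact k * partite_density k l"
  have p: "0 < p" using partite_density_pos[OF k(2)] by (simp add: p_def)
  have dens: "turan_density k \<F> = p"
    using turan_density_eq[OF _ _ tp] k by (simp add: p_def)
  obtain \<epsilon> n0 where \<epsilon>: "0 < \<epsilon>" and stab: "\<And>H. kgraph k H \<Longrightarrow> free_of \<F> H \<Longrightarrow> n0 \<le> card (verts H) \<Longrightarrow>
      (p / fact (k - 1) - \<epsilon>) * real (card (verts H)) ^ (k - 1) \<le> real (min_degree H) \<Longrightarrow>
      H \<in> Col k (complete_pattern k l)"
    using ds unfolding degree_stable_def dens by blast
  obtain \<delta> where \<delta>: "0 < \<delta>" "\<delta> < 1" and
    thr: "p / fact (k - 1) - \<epsilon> \<le> (1 - \<delta>) * (1 - \<delta>) powr ((\<alpha> - 1) / \<alpha>) * p / fact (k - 1) - ((1 + \<delta>) ^ (k - 1) - 1)"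
    using exists_flatness_threshold[OF \<epsilon>] by blast
  have k0: "0 < k" using k by simp
  show ?thesis
  proof (rule that[OF \<delta>, of n0])
    fix G x assume G: "kgraph k G" and free: "free_of \<F> G" and n0: "n0 \<le> card (verts G)" and ne: "verts G \<noteq> {}"
      and x: "\<forall>i. 0 \<le> x i" "(\<Sum>i\<in>verts G. x i powr \<alpha>) = 1"
      and lam: "spectral_lambda k \<alpha> G = fact k * edge_sum (edges G) x"
      and flat: "\<forall>i\<in>verts G. (1 - \<delta>) / real (card (verts G)) \<le> x i powr \<alpha>"
      and large: "(1 - \<delta>) * (fact k * partite_density k l * real (card (verts G)) powr (real k - real k / \<alpha>)) \<le> spectral_lambda k \<alpha> G"
    have fV: "finite (verts G)" using G by (simp add: kgraph_def)
    have "min_degree G \<in> vertex_degree G ` verts G"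
      unfolding min_degree_def using fV ne by (intro Min_in) auto
    then obtain v where v: "v \<in> verts G" "min_degree G = vertex_degree G v" by blast
    have "(p / fact (k - 1) - \<epsilon>) * real (card (verts G)) ^ (k - 1)
        \<le> ((1 - \<delta>) * (1 - \<delta>) powr ((\<alpha> - 1) / \<alpha>) * p / fact (k - 1) - ((1 + \<delta>) ^ (k - 1) - 1)) * real (card (verts G)) ^ (k - 1)"
      using thr by (intro mult_right_mono) auto
    also have "\<dots> \<le> real (vertex_degree G v)"
      by (rule degree_ge_of_flat_vector[OF G k0 \<alpha> \<delta> p _ x(2) lam _ _ v(1)])
        (use x(1) flat large in \<open>auto simp: p_def\<close>)
    finally have "G \<in> Col k (complete_pattern k l)"
      using stab[OF G free n0] v(2) by simp
    then show "colorable (complete_pattern k l) G" by (simp add: Col_def)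
  qed
qed

section \<open>Iterated deletion and asymptotic comparison\<close>

text \<open>A crude bound by the number of vertex subsets, for the graph left when the deletions
  have reached \<open>N\<close> vertices.\<close>

lemma spectral_lambda_le_power_card:
  assumes G: "kgraph k G" and ne: "verts G \<noteq> {}" and \<alpha>: "0 < \<alpha>"
  shows "spectral_lambda k \<alpha> G \<le> fact k * 2 ^ card (verts G)"
proof -
  obtain x where x: "\<And>i. 0 \<le> x i" "(\<Sum>i\<in>verts G. x i powr \<alpha>) = 1"
    "spectral_lambda k \<alpha> G = fact k * edge_sum (edges G) x"
    using spectral_lambda_attained[OF G ne \<alpha>] by blast
  have "edges G \<subseteq> Pow (verts G)" "finite (verts G)" using G by (auto simp: kgraph_def)
  then have "card (edges G) \<le> 2 ^ card (verts G)"
    using card_mono[of "Pow (verts G)" "edges G"] by (simp add: card_Pow)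
  then have "real (card (edges G)) \<le> 2 ^ card (verts G)"
    by (metis of_nat_le_iff of_nat_numeral of_nat_power)
  moreover have "edge_sum (edges G) x \<le> real (card (edges G))"
    using x by (intro edge_sum_unit_le_card[OF G \<alpha>]) simp
  ultimately have "edge_sum (edges G) x \<le> 2 ^ card (verts G)" by linarith
  then show ?thesis unfolding x(3) by (rule mult_left_mono) simp
qed

text \<open>Light vertices are deleted repeatedly; the two arguments of the maximum correspond to stopping
  at a graph with flat eigenvector and to running down to \<open>N\<close> vertices.\<close>

lemma spectral_lambda_light_le:
  fixes \<alpha> \<delta> p M :: real and k N :: nat
  defines "\<beta> \<equiv> real k - real k / \<alpha>"
  defines "B \<equiv> \<lambda>m. max (p * real m powr (\<beta> * \<delta> / 2)) M"
  assumes k: "0 < k" and \<alpha>: "1 < \<alpha>" and \<delta>: "0 < \<delta>" "\<delta> < 1" and p: "0 < p"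
    and N: "2 \<le> N" "8 * (real k)\<^sup>2 / (\<beta> * \<delta>) \<le> real N"
    and M: "fact k * 2 ^ N \<le> M"
    and flat: "\<And>G x. kgraph k G \<Longrightarrow> free_of \<F> G \<Longrightarrow> N \<le> card (verts G) \<Longrightarrow> \<forall>i. 0 \<le> x i \<Longrightarrow>
      (\<Sum>i\<in>verts G. x i powr \<alpha>) = 1 \<Longrightarrow> spectral_lambda k \<alpha> G = fact k * edge_sum (edges G) x \<Longrightarrow>
      \<forall>i\<in>verts G. (1 - \<delta>) / real (card (verts G)) \<le> x i powr \<alpha> \<Longrightarrow>
      spectral_lambda k \<alpha> G \<le> p * real (card (verts G)) powr \<beta>"
    and G: "kgraph k G" "free_of \<F> G" and lt: "N < card (verts G)"
    and x: "\<And>i. 0 \<le> x i" "(\<Sum>i\<in>verts G. x i powr \<alpha>) = 1"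
      "spectral_lambda k \<alpha> G = fact k * edge_sum (edges G) x"
    and v: "v \<in> verts G" "x v powr \<alpha> < (1 - \<delta>) / real (card (verts G))"
  shows "spectral_lambda k \<alpha> G \<le> real (card (verts G)) powr (\<beta> * (1 - \<delta> / 2)) * B (card (verts G) - 1)"
proof -
  define c where "c = \<beta> * (1 - \<delta> / 2)"
  have "real k / \<alpha> < real k" using k \<alpha> by (simp add: divide_less_eq)
  then have \<beta>: "0 < \<beta>" by (simp add: \<beta>_def)
  have c0: "0 < c" using \<beta> \<delta> by (simp add: c_def)
  have c\<eta>: "c + \<beta> * \<delta> / 2 = \<beta>" by (simp add: c_def algebra_simps)
  \<comment> \<open>One deletion: the factor \<open>(real m / real (m - 1)) powr c\<close>
    telescopes with the power of \<open>m - 1\<close> in the bound for the smaller graph, while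
    \<open>B\<close> keeps its argument.\<close>
  have light: "spectral_lambda k \<alpha> H \<le> real m powr c * B (m - 1)"
    if H: "kgraph k H" "card (verts H) = m" "N < m"
      and IH: "spectral_lambda k \<alpha> (delete_vertex H v) \<le> real (m - 1) powr c * B (m - 1)"
      and x: "\<And>i. 0 \<le> x i" "(\<Sum>i\<in>verts H. x i powr \<alpha>) = 1"
        "spectral_lambda k \<alpha> H = fact k * edge_sum (edges H) x"
      and v: "v \<in> verts H" "x v powr \<alpha> < (1 - \<delta>) / real m" for H m x v
  proof -
    have "spectral_lambda k \<alpha> H \<le> (real m / real (m - 1)) powr c * spectral_lambda k \<alpha> (delete_vertex H v)"
      unfolding c_def \<beta>_def
      by (rule spectral_lambda_delete_light_vertex[OF H(1) k \<alpha> \<delta> x v(1)])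
        (use v H N in \<open>auto simp: \<beta>_def\<close>)
    also have "\<dots> \<le> (real m / real (m - 1)) powr c * (real (m - 1) powr c * B (m - 1))"
      using IH by (intro mult_left_mono) auto
    also have "(real m / real (m - 1)) powr c * (real (m - 1) powr c * B (m - 1))
        = ((real m / real (m - 1)) powr c * real (m - 1) powr c) * B (m - 1)" by simp
    also have "(real m / real (m - 1)) powr c * real (m - 1) powr c = real m powr c"
      using H(3) N by (simp add: powr_mult[symmetric])
    finally show ?thesis .
  qed
  have del: "kgraph k (delete_vertex H v)" "free_of \<F> (delete_vertex H v)" "card (verts (delete_vertex H v)) = card (verts H) - 1"
    if "kgraph k H" "free_of \<F> H" "v \<in> verts H" for H v
    using that kgraph_delete_vertex free_of_delete_vertex by (auto simp: delete_vertex_def kgraph_def)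
  have main: "kgraph k H \<Longrightarrow> free_of \<F> H \<Longrightarrow> card (verts H) = m \<Longrightarrow> spectral_lambda k \<alpha> H \<le> real m powr c * B m"
    if "N \<le> m" for m H
    using that
  proof (induction m arbitrary: H rule: dec_induct)
    case base
    have "verts H \<noteq> {}" using base N by auto
    then have "spectral_lambda k \<alpha> H \<le> 1 * M"
      using spectral_lambda_le_power_card[OF base(1), of \<alpha>] M base \<alpha> by simp
    also have "\<dots> \<le> real N powr c * B N"
    proof (rule mult_mono)
      show "1 \<le> real N powr c" using N c0 by (intro ge_one_powr_ge_zero) auto
      have "0 \<le> fact k * (2::real) ^ N" by simp
      then show "0 \<le> M" using M by linarith
    qed (auto simp: B_def)
    finally show ?case .
  next
    case (step m)
    have ne: "verts H \<noteq> {}" using step.prems by auto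
    have \<alpha>0: "0 < \<alpha>" using \<alpha> by simp
    obtain x where x: "\<And>i. 0 \<le> x i" "(\<Sum>i\<in>verts H. x i powr \<alpha>) = 1"
      "spectral_lambda k \<alpha> H = fact k * edge_sum (edges H) x"
      using spectral_lambda_attained[OF step.prems(1) ne \<alpha>0] by blast
    show ?case
    proof (cases "\<forall>i\<in>verts H. (1 - \<delta>) / real (card (verts H)) \<le> x i powr \<alpha>")
      case True
      have "spectral_lambda k \<alpha> H \<le> p * real (Suc m) powr \<beta>"
        using flat[OF step.prems(1,2) _ _ x(2,3) True] x(1) step.hyps step.prems(3) by simp
      \<comment> \<open>The exponent \<open>\<beta>\<close> splits as
        \<open>c + \<beta> * \<delta> / 2\<close>, and the second part is the first argument of the
        maximum in \<open>B\<close>.\<close>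
      also have "\<dots> = real (Suc m) powr c * (p * real (Suc m) powr (\<beta> * \<delta> / 2))"
        using powr_add[of "real (Suc m)" c "\<beta> * \<delta> / 2"] unfolding c\<eta> by (simp only: mult_ac)
      also have "\<dots> \<le> real (Suc m) powr c * B (Suc m)"
        by (intro mult_left_mono) (auto simp: B_def)
      finally show ?thesis .
    next
      case False
      then obtain v where v: "v \<in> verts H" "x v powr \<alpha> < (1 - \<delta>) / real (Suc m)"
        using step.prems by (auto simp: not_le)
      have "spectral_lambda k \<alpha> (delete_vertex H v) \<le> real m powr c * B m"
        using del[OF step.prems(1,2) v(1)] step.prems(3) by (intro step.IH) auto
      then have "spectral_lambda k \<alpha> H \<le> real (Suc m) powr c * B m"
        using light[OF step.prems(1,3) _ _ x v] step.hyps by simp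
      also have "\<dots> \<le> real (Suc m) powr c * B (Suc m)"
      proof (rule mult_left_mono)
        have "p * real m powr (\<beta> * \<delta> / 2) \<le> p * real (Suc m) powr (\<beta> * \<delta> / 2)"
          using p \<beta> \<delta> by (intro mult_left_mono powr_mono2) auto
        then show "B m \<le> B (Suc m)" unfolding B_def by linarith
      qed simp
      finally show ?thesis .
    qed
  qed
  \<comment> \<open>The deletion from \<open>G\<close> itself is kept apart. Ending with
    \<open>B\<close> at one vertex fewer leaves a relative gain of order \<open>1 / n\<close> for
    the comparison with the Turan graph.\<close>
  have "spectral_lambda k \<alpha> (delete_vertex G v) \<le> real (card (verts G) - 1) powr c * B (card (verts G) - 1)"
    using del[OF G(1,2) v(1)] lt by (intro main) auto
  from light[OF G(1) refl lt this x v]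
  show "spectral_lambda k \<alpha> G \<le> real (card (verts G)) powr (\<beta> * (1 - \<delta> / 2)) * B (card (verts G) - 1)"
    by (simp add: c_def)
qed

text \<open>Going from \<open>n - 1\<close> to \<open>n\<close> gains a relative amount of about
  \<open>\<eta> / n\<close>, which outweighs the loss \<open>C / n\<^sup>2\<close>; the constant
  \<open>M\<close> is overtaken because the power of \<open>n\<close> is unbounded.\<close>

lemma eventually_beats_bound:
  fixes \<eta> p M C :: real
  assumes \<eta>: "0 < \<eta>" and p: "0 < p" and C: "0 \<le> C"
  shows "\<forall>\<^sub>F n in sequentially. max (p * real (n - 1) powr \<eta>) M < p * real n powr \<eta> * (1 - C / (real n)\<^sup>2)"
proof -
  have f1: "filterlim (\<lambda>n::nat. real n powr \<eta>) at_top sequentially"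
    using \<eta> by (intro filterlim_compose[OF real_powr_at_top filterlim_real_sequentially])
  have e1: "\<forall>\<^sub>F n::nat in sequentially. 2 * \<bar>M\<bar> / p + 1 \<le> real n powr \<eta>"
    using f1 unfolding filterlim_at_top by blast
  \<comment> \<open>The threshold \<open>2 * C\<close> keeps the correction factor at least
    \<open>1 / 2\<close>; the last one makes the linear gain exceed the quadratic terms
    strictly.\<close>
  have e2: "\<forall>\<^sub>F n::nat in sequentially. max 2 (max (2 * C) ((\<eta>\<^sup>2 + C) / \<eta> + 1)) \<le> real n"
    using filterlim_real_sequentially unfolding filterlim_at_top by blast
  show ?thesis
    using e1 e2
  proof eventually_elim
    case (elim n)
    have n2: "2 \<le> real n" and nC: "2 * C \<le> real n" and n\<eta>: "(\<eta>\<^sup>2 + C) / \<eta> < real n"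
      using elim(2) by auto
    have n0: "0 < real n" using n2 by simp
    have nn: "1 \<le> n" using n2 by simp
    have half: "1 / 2 \<le> 1 - C / (real n)\<^sup>2"
    proof -
      have "real n * 1 \<le> real n * real n" using n2 by (intro mult_left_mono) auto
      then have "2 * C \<le> real n * real n" using nC by linarith
      then show ?thesis using n0 by (simp add: divide_le_eq power2_eq_square)
    qed
    have "M < p * real n powr \<eta> * (1 / 2)"
    proof -
      have "2 * \<bar>M\<bar> / p < real n powr \<eta>" using elim(1) by simp
      then have "2 * \<bar>M\<bar> < p * real n powr \<eta>" using p by (simp add: divide_less_eq mult.commute)
      then show ?thesis by linarith
    qed
    also have "\<dots> \<le> p * real n powr \<eta> * (1 - C / (real n)\<^sup>2)"
      using half p by (intro mult_left_mono) auto
    finally have M: "M < p * real n powr \<eta> * (1 - C / (real n)\<^sup>2)" .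
    have "real (n - 1) = real n * (1 - 1 / real n)" using nn n0 by (simp add: of_nat_diff field_simps)
    then have "real (n - 1) powr \<eta> = real n powr \<eta> * (1 - 1 / real n) powr \<eta>"
      using n2 by (simp add: powr_mult)
    moreover have "(1 - 1 / real n) powr \<eta> < 1 - C / (real n)\<^sup>2"
    proof -
      have "(1 - 1 / real n) powr \<eta> \<le> exp (- (\<eta> * (1 / real n)))"
        using \<eta> n2 by (intro one_minus_powr_le_exp) auto
      also have "\<dots> \<le> 1 - \<eta> * (1 / real n) + (\<eta> * (1 / real n))\<^sup>2"
        using \<eta> n0 by (intro exp_minus_le_quadratic) auto
      also have "\<dots> < 1 - C / (real n)\<^sup>2"
      proof -
        have "\<eta>\<^sup>2 + C < real n * \<eta>" using n\<eta> \<eta> by (simp add: divide_less_eq)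
        then have "(\<eta>\<^sup>2 + C) / (real n)\<^sup>2 < (real n * \<eta>) / (real n)\<^sup>2"
          using n0 by (intro divide_strict_right_mono) auto
        moreover have "(real n * \<eta>) / (real n)\<^sup>2 = \<eta> * (1 / real n)"
          using n0 by (simp add: power2_eq_square)
        moreover have "(\<eta> * (1 / real n))\<^sup>2 = \<eta>\<^sup>2 / (real n)\<^sup>2" by (simp add: power_divide)
        ultimately show ?thesis using add_divide_distrib[of "\<eta>\<^sup>2" C "(real n)\<^sup>2"] by linarith
      qed
      finally show ?thesis .
    qed
    ultimately have "p * real (n - 1) powr \<eta> < p * real n powr \<eta> * (1 - C / (real n)\<^sup>2)"
      using p n0 by simp
    then show ?case using M by simp
  qed
qed

section \<open>Comparison with the Turan graph and the equality case\<close>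

text \<open>Every balanced complete partite graph on the vertices of \<open>G\<close> is isomorphic
  to the Turan graph, which supplies the constant for \<open>partite_sum_le_balanced\<close>. Since
  \<open>x\<close> is positive, a missing partite edge loses strictly, and so does an unbalanced
  coloring; equality excludes both.\<close>

lemma colorable_spectral_le_turan:
  assumes k: "2 \<le> k" "k \<le> l" and \<alpha>: "1 < \<alpha>" and G: "kgraph k G" and n: "card (verts G) = n"
    and col: "colorable (complete_pattern k l) G"
    and x: "\<And>i. i \<in> verts G \<Longrightarrow> 0 < x i" "(\<Sum>i\<in>verts G. x i powr \<alpha>) = 1"
    and lam: "spectral_lambda k \<alpha> G = fact k * edge_sum (edges G) x" "0 < spectral_lambda k \<alpha> G"
    and \<rho>: "0 < spectral_lambda k \<alpha> (turan_graph k l n)"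
  shows "spectral_lambda k \<alpha> G \<le> spectral_lambda k \<alpha> (turan_graph k l n)"
    and "spectral_lambda k \<alpha> G = spectral_lambda k \<alpha> (turan_graph k l n) \<Longrightarrow> isomorphic G (turan_graph k l n)"
proof -
  let ?V = "verts G" and ?\<rho> = "spectral_lambda k \<alpha> (turan_graph k l n)" and ?L = "{1..l}"
  have fV: "finite ?V" using G by (simp add: kgraph_def)
  have l: "0 < l" and k0: "0 < k" and \<alpha>0: "0 < \<alpha>" and Lne: "?L \<noteq> {}" using k \<alpha> by auto
  have xx: "\<forall>i\<in>?V. 0 < x i" using x(1) by blast
  obtain \<phi> where \<phi>: "\<phi> ` ?V \<subseteq> ?L" and E: "edges G \<subseteq> partite_edges k ?V \<phi>"
    using col colorable_complete_pattern[OF G] by blast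
  have fP: "finite (partite_edges k ?V \<phi>)" using fV by (rule finite_partite_edges)
  have iso: "isomorphic (?V, partite_edges k ?V \<psi>) (turan_graph k l n)"
    if "\<psi> ` ?V \<subseteq> ?L" "balanced_on ?V ?L \<psi>" for \<psi>
    unfolding turan_graph_eq
    by (rule isomorphic_partite[OF fV _ _ _ Lne that turan_coloring_image[OF l] balanced_turan_coloring[OF l]])
      (simp_all add: n)
  have bal: "(\<Sum>e\<in>partite_edges k ?V \<psi>. \<Prod>v\<in>e. y v) \<le> ?\<rho> / fact k * (\<Sum>v\<in>?V. y v powr \<alpha>) powr (real k / \<alpha>)"
    if \<psi>: "\<psi> ` ?V \<subseteq> ?L" "balanced_on ?V ?L \<psi>" and y: "\<forall>v\<in>?V. 0 < y v" for \<psi> y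
  proof -
    let ?K = "(?V, partite_edges k ?V \<psi>)"
    have K: "kgraph k ?K" using fV by (auto simp: kgraph_def partite_edges_def)
    have "spectral_lambda k \<alpha> ?K = ?\<rho>" using spectral_lambda_isomorphic[OF K iso[OF \<psi>]] .
    then have "fact k * edge_sum (partite_edges k ?V \<psi>) y \<le> ?\<rho> * (\<Sum>v\<in>?V. y v powr \<alpha>) powr (real k / \<alpha>)"
      using edge_sum_le_spectral_lambda[OF K k0 \<alpha>0, of y] y by (auto intro: less_imp_le)
    then show ?thesis by (simp add: edge_sum_def pos_le_divide_eq mult.commute)
  qed
  have es: "0 < edge_sum (edges G) x" using lam by (simp add: zero_less_mult_iff)
  then have "edges G \<noteq> {}" by (auto simp: edge_sum_def)
  then have ne: "partite_edges k ?V \<phi> \<noteq> {}" using E by blast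
  have \<rho>k: "0 < ?\<rho> / fact k" using \<rho> by simp
  let ?val = "\<Sum>e\<in>partite_edges k ?V \<phi>. \<Prod>v\<in>e. x v"
  have "?val \<le> ?\<rho> / fact k * (\<Sum>v\<in>?V. x v powr \<alpha>) powr (real k / \<alpha>) \<and>
      (\<not> balanced_on ?V ?L \<phi> \<longrightarrow> ?val < ?\<rho> / fact k * (\<Sum>v\<in>?V. x v powr \<alpha>) powr (real k / \<alpha>))"
    by (rule partite_sum_le_balanced[OF fV finite_atLeastAtMost k(1) \<alpha> \<rho>k _ \<phi> xx ne]) (rule bal)
  then have b: "?val \<le> ?\<rho> / fact k" "\<not> balanced_on ?V ?L \<phi> \<longrightarrow> ?val < ?\<rho> / fact k"
    unfolding x(2) by simp_all
  have pos: "0 < (\<Prod>v\<in>e. x v)" if "e \<in> partite_edges k ?V \<phi>" for e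
    using that x(1) by (intro prod_pos) (auto simp: partite_edges_def)
  have le: "edge_sum (edges G) x \<le> ?val"
    unfolding edge_sum_def using fP E pos by (intro sum_mono2) (auto intro: less_imp_le)
  have lt: "edge_sum (edges G) x < ?val" if neq: "edges G \<noteq> partite_edges k ?V \<phi>"
  proof -
    obtain e where "e \<in> partite_edges k ?V \<phi> - edges G" using neq E by blast
    then show ?thesis unfolding edge_sum_def
      using fP E pos by (intro sum_strict_mono2[of _ _ e]) (auto intro: less_imp_le)
  qed
  have "edge_sum (edges G) x \<le> ?\<rho> / fact k" using le b by linarith
  then show "spectral_lambda k \<alpha> G \<le> ?\<rho>" unfolding lam by (simp add: pos_le_divide_eq mult.commute)
  assume "spectral_lambda k \<alpha> G = ?\<rho>"
  then have eq: "edge_sum (edges G) x = ?\<rho> / fact k" unfolding lam by (simp add: field_simps)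
  then have "edges G = partite_edges k ?V \<phi>" using lt b by force
  moreover have "balanced_on ?V ?L \<phi>" using le eq b by force
  ultimately show "isomorphic G (turan_graph k l n)"
    using iso[OF \<phi>] by (metis prod.collapse)
qed

theorem theorem3p3:
  fixes k l :: nat and \<F> :: "hypergraph set" and \<alpha> :: real
  assumes "2 \<le> k" and "k \<le> l"
    and "\<forall>A\<in>\<F>. kgraph k A"
    and "turan_pair k \<F> (complete_pattern k l)"
    and "degree_stable k \<F> (Col k (complete_pattern k l))"
    and "\<alpha> > 1"
  shows "\<exists>n0. \<forall>n\<ge>n0. \<forall>G. kgraph k G \<and> card (verts G) = n \<and> free_of \<F> G \<longrightarrow>
           spectral_lambda k \<alpha> G \<le> spectral_lambda k \<alpha> (turan_graph k l n) \<and>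
           (spectral_lambda k \<alpha> G = spectral_lambda k \<alpha> (turan_graph k l n) \<longleftrightarrow>
              isomorphic G (turan_graph k l n))"
proof -
  have k0: "0 < k" and l: "0 < l" and \<alpha>: "1 < \<alpha>" "0 < \<alpha>" using assms by auto
  define p where "p = fact k * partite_density k l"
  define \<beta> where "\<beta> = real k - real k / \<alpha>"
  \<comment> \<open>The constant of the relative error in
    \<open>spectral_lambda_turan_graph_ge\<close>.\<close>
  define C where "C = (real (k - 1) * real l)\<^sup>2"
  have p: "0 < p" using partite_density_pos[OF assms(2)] by (simp add: p_def)
  have "real k / \<alpha> < real k" using k0 \<alpha> by (simp add: divide_less_eq)
  then have \<beta>: "0 < \<beta>" by (simp add: \<beta>_def)
  obtain \<delta> N1 where \<delta>: "0 < \<delta>" "\<delta> < 1" and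
    flat: "\<And>G x. kgraph k G \<Longrightarrow> free_of \<F> G \<Longrightarrow> N1 \<le> card (verts G) \<Longrightarrow> verts G \<noteq> {} \<Longrightarrow> \<forall>i. 0 \<le> x i \<Longrightarrow>
      (\<Sum>i\<in>verts G. x i powr \<alpha>) = 1 \<Longrightarrow> spectral_lambda k \<alpha> G = fact k * edge_sum (edges G) x \<Longrightarrow>
      \<forall>i\<in>verts G. (1 - \<delta>) / real (card (verts G)) \<le> x i powr \<alpha> \<Longrightarrow>
      (1 - \<delta>) * (p * real (card (verts G)) powr \<beta>) \<le> spectral_lambda k \<alpha> G \<Longrightarrow>
      colorable (complete_pattern k l) G"
  proof (rule flat_vector_imp_colorable[OF assms(1,2,4,5) \<alpha>(1), folded p_def, folded \<beta>_def], goal_cases)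
    case (1 \<delta> N)
    show ?case by (rule 1(1)[OF 1(2,3)]) (rule 1(4))
  qed
  \<comment> \<open>Deletions stop at this order: above it flat vectors still force colorability and
    the deletion estimate still applies.\<close>
  define N where "N = max 2 (max N1 (nat \<lceil>8 * (real k)\<^sup>2 / (\<beta> * \<delta>)\<rceil>))"
  have "8 * (real k)\<^sup>2 / (\<beta> * \<delta>) \<le> real (nat \<lceil>8 * (real k)\<^sup>2 / (\<beta> * \<delta>)\<rceil>)"
    by (rule real_nat_ceiling_ge)
  also have "\<dots> \<le> real N" unfolding N_def by (intro of_nat_mono max.coboundedI2 order_refl)
  finally have N_ge: "8 * (real k)\<^sup>2 / (\<beta> * \<delta>) \<le> real N" .
  have N: "2 \<le> N" "N1 \<le> N" by (auto simp: N_def)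
  define M :: real where "M = fact k * 2 ^ N"
  define \<eta> where "\<eta> = \<beta> * \<delta> / 2"
  have \<eta>: "0 < \<eta>" using \<beta> \<delta> by (simp add: \<eta>_def)
  \<comment> \<open>A larger value would meet the size condition of \<open>flat\<close>, so
    \<open>G\<close> would be colorable, contradicting the bound for colorable graphs.\<close>
  have flat_le: "spectral_lambda k \<alpha> G \<le> p * real (card (verts G)) powr \<beta>"
    if G: "kgraph k G" "free_of \<F> G" "N \<le> card (verts G)" and x: "\<forall>i. 0 \<le> x i"
      "(\<Sum>i\<in>verts G. x i powr \<alpha>) = 1" "spectral_lambda k \<alpha> G = fact k * edge_sum (edges G) x"
      "\<forall>i\<in>verts G. (1 - \<delta>) / real (card (verts G)) \<le> x i powr \<alpha>" for G x
  proof (rule ccontr)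
    assume "\<not> ?thesis"
    then have gt: "p * real (card (verts G)) powr \<beta> < spectral_lambda k \<alpha> G" by simp
    have ne: "verts G \<noteq> {}" using G(3) N by auto
    have "(1 - \<delta>) * (p * real (card (verts G)) powr \<beta>) \<le> 1 * (p * real (card (verts G)) powr \<beta>)"
      using \<delta> p by (intro mult_right_mono) auto
    then have "colorable (complete_pattern k l) G"
      using flat[OF G(1,2) _ ne x] G(3) N gt by linarith
    from spectral_lambda_colorable_le[OF G(1) this ne \<alpha>(1)] show False
      using gt by (simp add: p_def \<beta>_def)
  qed
  have ev1: "\<forall>\<^sub>F n in sequentially. max (p * real (n - 1) powr \<eta>) M < p * real n powr \<eta> * (1 - C / (real n)\<^sup>2)"
    by (rule eventually_beats_bound[OF \<eta> p]) (simp add: C_def)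
  have "(\<lambda>n. 1 - C / (real n)\<^sup>2) \<longlonglongrightarrow> 1 - 0"
    by (intro tendsto_intros tendsto_divide_0[OF tendsto_const] filterlim_at_top_imp_at_infinity
        filterlim_pow_at_top filterlim_real_sequentially) auto
  then have "\<forall>\<^sub>F n in sequentially. 1 - \<delta> < 1 - C / (real n)\<^sup>2"
    using \<delta> by (intro order_tendstoD(1)) auto
  with ev1 have "\<forall>\<^sub>F n in sequentially. (max (p * real (n - 1) powr \<eta>) M < p * real n powr \<eta> * (1 - C / (real n)\<^sup>2)
      \<and> 1 - \<delta> < 1 - C / (real n)\<^sup>2) \<and> max l (Suc N) \<le> n"
    by (intro eventually_conj eventually_ge_at_top)
  then obtain n0 where ev: "\<forall>n\<ge>n0. (max (p * real (n - 1) powr \<eta>) M < p * real n powr \<eta> * (1 - C / (real n)\<^sup>2)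
      \<and> 1 - \<delta> < 1 - C / (real n)\<^sup>2) \<and> max l (Suc N) \<le> n"
    unfolding eventually_sequentially by blast
  show ?thesis
  proof (intro exI[of _ n0] allI impI, elim conjE)
    fix n G assume n: "n0 \<le> n" and G: "kgraph k G" and card: "card (verts G) = n" and free: "free_of \<F> G"
    let ?\<rho> = "spectral_lambda k \<alpha> (turan_graph k l n)" and ?lam = "spectral_lambda k \<alpha> G"
    have beat: "max (p * real (n - 1) powr \<eta>) M < p * real n powr \<eta> * (1 - C / (real n)\<^sup>2)"
      and fac: "1 - \<delta> < 1 - C / (real n)\<^sup>2" and "max l (Suc N) \<le> n"
      using ev n by blast+
    then have ln: "l \<le> n" "N < n" by auto
    have npos: "0 < real n" using ln by simp
    have ne: "verts G \<noteq> {}" using card ln by auto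
    have low: "p * real n powr \<beta> * (1 - C / (real n)\<^sup>2) \<le> ?\<rho>"
      using spectral_lambda_turan_graph_ge[OF l k0 ln(1) \<alpha>(1)]
      by (simp add: p_def \<beta>_def C_def power_divide power_mult_distrib)
    have "0 < 1 - C / (real n)\<^sup>2" using fac \<delta> by linarith
    then have "0 < p * real n powr \<beta> * (1 - C / (real n)\<^sup>2)"
      using p npos by (intro mult_pos_pos) simp_all
    then have \<rho>: "0 < ?\<rho>" using low by linarith
    have iso_eq: "?lam = ?\<rho>" if "isomorphic G (turan_graph k l n)"
      using spectral_lambda_isomorphic[OF G that] .
    \<comment> \<open>Only this case needs analysis: if \<open>?lam\<close> is smaller than
      \<open>?\<rho>\<close>, then \<open>iso_eq\<close> excludes an isomorphism.\<close>
    have main: "?lam \<le> ?\<rho> \<and> (?lam = ?\<rho> \<longrightarrow> isomorphic G (turan_graph k l n))" if ge: "?\<rho> \<le> ?lam"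
    proof -
      obtain x where x: "\<And>i. 0 \<le> x i" "(\<Sum>i\<in>verts G. x i powr \<alpha>) = 1"
        "?lam = fact k * edge_sum (edges G) x"
        using spectral_lambda_attained[OF G ne \<alpha>(2)] by blast
      \<comment> \<open>A light vertex would push \<open>?lam\<close> strictly below the lower bound
        for the Turan graph, by the choice of \<open>n0\<close>.\<close>
      have fl: "(1 - \<delta>) / real n \<le> x i powr \<alpha>" if i: "i \<in> verts G" for i
      proof (rule ccontr)
        assume "\<not> ?thesis"
        then have light: "x i powr \<alpha> < (1 - \<delta>) / real (card (verts G))" using card by simp
        have "?lam \<le> real n powr (\<beta> * (1 - \<delta> / 2)) * max (p * real (n - 1) powr \<eta>) M"
          using spectral_lambda_light_le[OF k0 \<alpha>(1) \<delta> p N(1) N_ge[unfolded \<beta>_def] order_refl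
              flat_le[unfolded \<beta>_def] G free _ x i light] card ln
          by (simp add: \<beta>_def \<eta>_def M_def)
        also have "\<dots> < real n powr (\<beta> * (1 - \<delta> / 2)) * (p * real n powr \<eta> * (1 - C / (real n)\<^sup>2))"
          using beat npos by (intro mult_strict_left_mono) auto
        also have "\<dots> = p * real n powr \<beta> * (1 - C / (real n)\<^sup>2)"
        proof -
          have "\<beta> * (1 - \<delta> / 2) + \<eta> = \<beta>" by (simp add: \<eta>_def algebra_simps)
          then have "real n powr \<beta> = real n powr (\<beta> * (1 - \<delta> / 2)) * real n powr \<eta>"
            by (metis powr_add)
          then show ?thesis by (simp only: mult_ac)
        qed
        finally show False using low ge by linarith
      qed
      have xpos: "0 < x i" if "i \<in> verts G" for i
      proof -
        have "0 < (1 - \<delta>) / real n" using \<delta> npos by simp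
        then have "0 < x i powr \<alpha>" using fl[OF that] by linarith
        then show ?thesis using x(1)[of i] by (cases "x i = 0") auto
      qed
      \<comment> \<open>The Turan lower bound, inherited by \<open>?lam\<close>, is large enough for
        \<open>flat\<close> because its relative error is below \<delta>.\<close>
      have "(1 - \<delta>) * (p * real n powr \<beta>) \<le> (1 - C / (real n)\<^sup>2) * (p * real n powr \<beta>)"
        using fac p by (intro mult_right_mono) auto
      then have "(1 - \<delta>) * (p * real n powr \<beta>) \<le> ?lam" using low ge by (simp add: mult.commute)
      then have col: "colorable (complete_pattern k l) G"
        using flat[OF G free _ ne _ x(2,3)] x(1) fl card ln N by simp
      have "0 < ?lam" using \<rho> ge by linarith
      from colorable_spectral_le_turan[OF assms(1,2) \<alpha>(1) G card col xpos x(2,3) this \<rho>]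
      show ?thesis by blast
    qed
    show "?lam \<le> ?\<rho> \<and> (?lam = ?\<rho> \<longleftrightarrow> isomorphic G (turan_graph k l n))"
      using main iso_eq by (cases "?\<rho> \<le> ?lam") auto
  qed
qed

end
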